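(* Specifying a model of the essentially algebraic theory $\mathbb{T}_{\mathrm{NM}}$ of natural models is equivalent to specifying a natural model.
   Context: **Natural models.** Write $\mathsf{y}$ for the Yoneda embedding of a small category $\mathbb{C}$ into $\widehat{\mathbb{C}}=\mathbf{Set}^{\mathbb{C}^{\mathrm{op}}}$; elements $x\in P(\Gamma)$ are identified with maps $x:\mathsf{y}(\Gamma)\to P$. A natural model consists of a small category $\mathbb{C}$ with a distinguished terminal object $\diamond$, presheaves $\mathcal{U},\dot{\mathcal{U}}$ on $\mathbb{C}$, a natural transformation $p:\dot{\mathcal{U}}\to\mathcal{U}$ and, for each object $\Gamma$ and $A\in\mathcal{U}(\Gamma)$, an object $\Gamma\cdot A$, a morphism $\mathsf{p}_A:\Gamma\cdot A\to\Gamma$ and an element $\mathsf{q}_A\in\dot{\mathcal{U}}(\Gamma\cdot A)$ such that the square with top $\mathsf{q}_A:\mathsf{y}(\Gamma\cdot A)\to\dot{\mathcal{U}}$, right $p$, left $\mathsf{y}(\mathsf{p}_A)$, bottom $A:\mathsf{y}(\Gamma)\to\mathcal{U}$ is a pullback in $\widehat{\mathbb{C}}$. **The theory $\mathbb{T}_{\mathrm{NM}}$.** An essentially algebraic theory is given by sorts, operation symbols with arities (possibly partial, with domain of definition specified by equations), and equations. A model $\mathfrak{M}$ assigns a set $M_s$ to each sort $s$ and a (partial) function with the specified domain to each symbol, satisfying the equations. The sorts of $\mathbb{T}_{\mathrm{NM}}$ are $\mathsf{Ctx},\mathsf{Sub},\mathsf{Type},\mathsf{Term}$. Variables: $\Gamma,\Delta$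 of sort $\mathsf{Ctx}$; $\sigma,\tau,\upsilon$ of sort $\mathsf{Sub}$; $A$ of sort $\mathsf{Type}$; $a$ of sort $\mathsf{Term}$. The symbols are: - total: $\mathsf{dom},\mathsf{cod}:\mathsf{Sub}\to\mathsf{Ctx}$; $\mathsf{id}:\mathsf{Ctx}\to\mathsf{Sub}$, written $\mathsf{id}_\Gamma$; $\mathsf{empty}:\mathsf{Ctx}$, written $\diamond$; $\mathsf{esub}:\mathsf{Ctx}\to\mathsf{Sub}$, written $\mathsf{t}_\Gamma$; $\mathsf{typeof}:\mathsf{Term}\to\mathsf{Type}$; $\mathsf{ctxof}_{\mathsf{ty}}:\mathsf{Type}\to\mathsf{Ctx}$ and $\mathsf{ctxof}_{\mathsf{tm}}:\mathsf{Term}\to\mathsf{Ctx}$ (both written $\mathsf{ctxof}$); $\mathsf{cext}:\mathsf{Type}\to\mathsf{Ctx}$, written $\Gamma\cdot A$ where $\Gamma=\mathsf{ctxof}(A)$; $\mathsf{proj}:\mathsf{Type}\to\mathsf{Sub}$, written $\mathsf{p}_A$; $\mathsf{var}:\mathsf{Type}\to\mathsf{Term}$, written $\mathsf{q}_A$; - partial: $\mathsf{comp}:\mathsf{Sub}\times\mathsf{Sub}\to\mathsf{Sub}$, $\mathsf{comp}(\sigma,\tau)=\tau\circ\sigma$, defined when $\mathsf{cod}(\sigma)=\mathsf{dom}(\tau)$; $\mathsf{subst}_{\mathsf{ty}}:\mathsf{Sub}\times\mathsf{Type}\to\mathsf{Type}$, written $A[\sigma]$, defined when $\mathsf{ctxof}(A)=\mathsf{cod}(\sigma)$;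 $\mathsf{subst}_{\mathsf{tm}}:\mathsf{Sub}\times\mathsf{Term}\to\mathsf{Term}$, written $a[\sigma]$, defined when $\mathsf{ctxof}(a)=\mathsf{cod}(\sigma)$; $\mathsf{indsub}:\mathsf{Sub}\times\mathsf{Term}\times\mathsf{Type}\to\mathsf{Sub}$, $\mathsf{indsub}(\sigma,a,A)=\langle\sigma,a\rangle_A$, defined when $\mathsf{cod}(\sigma)=\mathsf{ctxof}(A)$ and $\mathsf{typeof}(a)=A[\sigma]$. The equations (27 in total) are: - category of contexts: $\mathsf{dom}(\mathsf{id}_\Gamma)=\Gamma$; $\mathsf{cod}(\mathsf{id}_\Gamma)=\Gamma$; $\mathsf{dom}(\tau\circ\sigma)=\mathsf{dom}(\sigma)$; $\mathsf{cod}(\tau\circ\sigma)=\mathsf{cod}(\tau)$; $\sigma\circ\mathsf{id}_\Gamma=\sigma$; $\mathsf{id}_\Delta\circ\tau=\tau$; $(\upsilon\circ\tau)\circ\sigma=\upsilon\circ(\tau\circ\sigma)$; - empty context is terminal: $\mathsf{dom}(\mathsf{t}_\Gamma)=\Gamma$; $\mathsf{cod}(\mathsf{t}_\Gamma)=\diamond$; $\mathsf{t}_\Gamma\circ\sigma=\mathsf{t}_\Delta$ (for $\sigma$ from $\Delta$ to $\Gamma$); - presheaf of types: $A[\mathsf{id}_{\mathsf{ctxof}(A)}]=A$; $A[\tau\circ\sigma]=A[\tau][\sigma]$; $\mathsf{ctxof}(A[\sigma])=\mathsf{dom}(\sigma)$; - presheaf of terms: $a[\mathsf{id}_{\mathsf{ctxof}(a)}]=a$;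 $a[\tau\circ\sigma]=a[\tau][\sigma]$; $\mathsf{ctxof}(a[\sigma])=\mathsf{dom}(\sigma)$; - typing is natural: $\mathsf{ctxof}(\mathsf{typeof}(a))=\mathsf{ctxof}(a)$; $\mathsf{typeof}(a[\sigma])=\mathsf{typeof}(a)[\sigma]$; - representability: $\mathsf{dom}(\mathsf{p}_A)=\Gamma\cdot A$; $\mathsf{cod}(\mathsf{p}_A)=\Gamma$; $\mathsf{ctxof}(\mathsf{q}_A)=\Gamma\cdot A$; $\mathsf{typeof}(\mathsf{q}_A)=A[\mathsf{p}_A]$; $\mathsf{dom}(\langle\sigma,a\rangle_A)=\mathsf{dom}(\sigma)$; $\mathsf{cod}(\langle\sigma,a\rangle_A)=\mathsf{cod}(\sigma)\cdot A$; $\mathsf{p}_A\circ\langle\sigma,a\rangle_A=\sigma$; $\mathsf{q}_A[\langle\sigma,a\rangle_A]=a$; $\langle\mathsf{p}_A\circ\sigma,\mathsf{q}_A[\sigma]\rangle_A=\sigma$.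
   Formalization: The 27 listed equations do not make the empty context terminal (one context, arrows id and e with e∘e = e, t = e, no types); the equation t_◇ = id_◇ is added to the theory, and is shown to be exactly what is needed for a model to give a natural model. *)

theory Defs
  imports Main
begin

section \<open>Essentially algebraic theories and their models\<close>

datatype ('s, 'f) eterm = Var 's nat | App 'f "('s, 'f) eterm list"

type_synonym ('s, 'f) equation = "('s, 'f) eterm \<times> ('s, 'f) eterm"

abbreviation equation_of ::
    "('s, 'f) eterm \<Rightarrow> ('s, 'f) eterm \<Rightarrow> ('s, 'f) equation" (infix "\<approx>" 50)
  where "t \<approx> u \<equiv> (t, u)"

text \<open>The equations \<open>dom_eqs T f\<close> specify the domain of definition of \<open>f\<close>; they are written in
  the variables \<open>Var (arity T f ! i) i\<close>, which stand for the arguments of \<open>f\<close>.  A total symbol is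
  one whose list of domain equations is empty.\<close>

record ('s, 'f) theory_pres =
  arity :: "'f \<Rightarrow> 's list"
  result :: "'f \<Rightarrow> 's"
  dom_eqs :: "'f \<Rightarrow> ('s, 'f) equation list"
  axioms :: "('s, 'f) equation list"

primrec term_sort :: "('s, 'f, 'x) theory_pres_scheme \<Rightarrow> ('s, 'f) eterm \<Rightarrow> 's" where
  "term_sort T (Var s i) = s"
| "term_sort T (App f ts) = result T f"

primrec well_sorted :: "('s, 'f, 'x) theory_pres_scheme \<Rightarrow> ('s, 'f) eterm \<Rightarrow> bool" where
  "well_sorted T (Var s i) \<longleftrightarrow> True"
| "well_sorted T (App f ts) \<longleftrightarrow>
     map (term_sort T) ts = arity T f \<and> list_all id (map (well_sorted T) ts)"

primrec vars :: "('s, 'f) eterm \<Rightarrow> ('s \<times> nat) set" where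
  "vars (Var s i) = {(s, i)}"
| "vars (App f ts) = \<Union> (set (map vars ts))"

definition well_sorted_eq :: "('s, 'f, 'x) theory_pres_scheme \<Rightarrow> ('s, 'f) equation \<Rightarrow> bool" where
  "well_sorted_eq T e \<longleftrightarrow>
     well_sorted T (fst e) \<and> well_sorted T (snd e) \<and> term_sort T (fst e) = term_sort T (snd e)"

definition ess_alg_theory :: "('s, 'f, 'x) theory_pres_scheme \<Rightarrow> bool" where
  "ess_alg_theory T \<longleftrightarrow>
     (\<forall>f. \<forall>e \<in> set (dom_eqs T f). well_sorted_eq T e \<and>
        (\<forall>(s, i) \<in> vars (fst e) \<union> vars (snd e). i < length (arity T f) \<and> s = arity T f ! i)) \<and>
     (\<forall>e \<in> set (axioms T). well_sorted_eq T e)"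

record ('s, 'f, 'u) interp =
  carrier :: "'s \<Rightarrow> 'u set"
  oper :: "'f \<Rightarrow> 'u list \<Rightarrow> 'u option"

primrec eval ::
    "('s, 'f, 'u, 'x) interp_scheme \<Rightarrow> ('s \<Rightarrow> nat \<Rightarrow> 'u) \<Rightarrow> ('s, 'f) eterm \<Rightarrow> 'u option" where
  "eval M v (Var s i) = Some (v s i)"
| "eval M v (App f ts) = Option.bind (those (map (eval M v) ts)) (oper M f)"

text \<open>An equation in a domain condition asserts that both sides are defined and equal.\<close>

definition holds ::
    "('s, 'f, 'u, 'x) interp_scheme \<Rightarrow> ('s \<Rightarrow> nat \<Rightarrow> 'u) \<Rightarrow> ('s, 'f) equation \<Rightarrow> bool" where
  "holds M v e \<longleftrightarrow> (\<exists>x. eval M v (fst e) = Some x \<and> eval M v (snd e) = Some x)"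

text \<open>A model satisfies an equation if the two sides agree whenever both are defined.  Only the
  variables occurring in the equation are interpreted, because carriers may be empty.\<close>

definition satisfies :: "('s, 'f, 'u, 'x) interp_scheme \<Rightarrow> ('s, 'f) equation \<Rightarrow> bool" where
  "satisfies M e \<longleftrightarrow>
     (\<forall>v. (\<forall>(s, i) \<in> vars (fst e) \<union> vars (snd e). v s i \<in> carrier M s) \<longrightarrow>
        (\<forall>x y. eval M v (fst e) = Some x \<and> eval M v (snd e) = Some y \<longrightarrow> x = y))"

definition eat_model ::
    "('s, 'f, 'x) theory_pres_scheme \<Rightarrow> ('s, 'f, 'u, 'y) interp_scheme \<Rightarrow> bool" where
  "eat_model T M \<longleftrightarrow>
     (\<forall>f. dom (oper M f) =
            {xs \<in> listset (map (carrier M) (arity T f)).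
               \<forall>e \<in> set (dom_eqs T f). holds M (\<lambda>s i. xs ! i) e}) \<and>
     (\<forall>f. ran (oper M f) \<subseteq> carrier M (result T f)) \<and>
     (\<forall>e \<in> set (axioms T). satisfies M e)"

definition model_iso ::
    "('s, 'f, 'x) theory_pres_scheme \<Rightarrow> ('s, 'f, 'u, 'y) interp_scheme \<Rightarrow>
     ('s, 'f, 'v, 'z) interp_scheme \<Rightarrow> bool" where
  "model_iso T M M' \<longleftrightarrow>
     (\<exists>h. (\<forall>s. bij_betw (h s) (carrier M s) (carrier M' s)) \<and>
          (\<forall>f. \<forall>xs \<in> listset (map (carrier M) (arity T f)).
             oper M' f (map2 h (arity T f) xs) = map_option (h (result T f)) (oper M f xs)))"

section \<open>The essentially algebraic theory of natural models\<close>

datatype nm_sort = Ctx | Sub | Type | Term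

datatype nm_symbol =
    DOM | COD | ID | EMPTY | ESUB | TYPEOF | CTXOF_TY | CTXOF_TM | CEXT | PROJ | VAR
  | COMP | SUBST_TY | SUBST_TM | INDSUB

type_synonym nm_term = "(nm_sort, nm_symbol) eterm"

abbreviation "dom' s \<equiv> App DOM [s]"
abbreviation "cod' s \<equiv> App COD [s]"
abbreviation "id' G \<equiv> App ID [G]"
abbreviation "empty' \<equiv> App EMPTY []"
abbreviation "esub' G \<equiv> App ESUB [G]"
abbreviation "typeof' a \<equiv> App TYPEOF [a]"
abbreviation "ctxof_ty' A \<equiv> App CTXOF_TY [A]"
abbreviation "ctxof_tm' a \<equiv> App CTXOF_TM [a]"
abbreviation "cext' A \<equiv> App CEXT [A]"
abbreviation "proj' A \<equiv> App PROJ [A]"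
abbreviation "var' A \<equiv> App VAR [A]"
abbreviation "comp' s t \<equiv> App COMP [s, t]"
abbreviation "subst_ty' s A \<equiv> App SUBST_TY [s, A]"
abbreviation "subst_tm' s a \<equiv> App SUBST_TM [s, a]"
abbreviation "indsub' s a A \<equiv> App INDSUB [s, a, A]"

fun nm_arity :: "nm_symbol \<Rightarrow> nm_sort list" where
  "nm_arity DOM = [Sub]"
| "nm_arity COD = [Sub]"
| "nm_arity ID = [Ctx]"
| "nm_arity EMPTY = []"
| "nm_arity ESUB = [Ctx]"
| "nm_arity TYPEOF = [Term]"
| "nm_arity CTXOF_TY = [Type]"
| "nm_arity CTXOF_TM = [Term]"
| "nm_arity CEXT = [Type]"
| "nm_arity PROJ = [Type]"
| "nm_arity VAR = [Type]"
| "nm_arity COMP = [Sub, Sub]"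
| "nm_arity SUBST_TY = [Sub, Type]"
| "nm_arity SUBST_TM = [Sub, Term]"
| "nm_arity INDSUB = [Sub, Term, Type]"

fun nm_result :: "nm_symbol \<Rightarrow> nm_sort" where
  "nm_result DOM = Ctx"
| "nm_result COD = Ctx"
| "nm_result ID = Sub"
| "nm_result EMPTY = Ctx"
| "nm_result ESUB = Sub"
| "nm_result TYPEOF = Type"
| "nm_result CTXOF_TY = Ctx"
| "nm_result CTXOF_TM = Ctx"
| "nm_result CEXT = Ctx"
| "nm_result PROJ = Sub"
| "nm_result VAR = Term"
| "nm_result COMP = Sub"
| "nm_result SUBST_TY = Type"
| "nm_result SUBST_TM = Term"
| "nm_result INDSUB = Sub"

fun nm_dom_eqs :: "nm_symbol \<Rightarrow> (nm_sort, nm_symbol) equation list" where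
  "nm_dom_eqs COMP = [cod' (Var Sub 0) \<approx> dom' (Var Sub 1)]"
| "nm_dom_eqs SUBST_TY = [ctxof_ty' (Var Type 1) \<approx> cod' (Var Sub 0)]"
| "nm_dom_eqs SUBST_TM = [ctxof_tm' (Var Term 1) \<approx> cod' (Var Sub 0)]"
| "nm_dom_eqs INDSUB =
     [cod' (Var Sub 0) \<approx> ctxof_ty' (Var Type 2),
      typeof' (Var Term 1) \<approx> subst_ty' (Var Sub 0) (Var Type 2)]"
| "nm_dom_eqs _ = []"

text \<open>\<open>comp' \<sigma> \<tau>\<close> is the composite \<open>\<tau> \<circ> \<sigma>\<close>.\<close>

definition nm_axioms :: "(nm_sort, nm_symbol) equation list" where
  "nm_axioms =
    (let \<Gamma> = Var Ctx 0; \<Delta> = Var Ctx 1;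
         \<sigma> = Var Sub 0; \<tau> = Var Sub 1; \<upsilon> = Var Sub 2;
         A = Var Type 0; a = Var Term 0 in
     [dom' (id' \<Gamma>) \<approx> \<Gamma>,
      cod' (id' \<Gamma>) \<approx> \<Gamma>,
      dom' (comp' \<sigma> \<tau>) \<approx> dom' \<sigma>,
      cod' (comp' \<sigma> \<tau>) \<approx> cod' \<tau>,
      comp' (id' \<Gamma>) \<sigma> \<approx> \<sigma>,
      comp' \<tau> (id' \<Delta>) \<approx> \<tau>,
      comp' \<sigma> (comp' \<tau> \<upsilon>) \<approx> comp' (comp' \<sigma> \<tau>) \<upsilon>,

      dom' (esub' \<Gamma>) \<approx> \<Gamma>,
      cod' (esub' \<Gamma>) \<approx> empty',
      comp' \<sigma> (esub' (cod' \<sigma>)) \<approx> esub' (dom' \<sigma>),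

      subst_ty' (id' (ctxof_ty' A)) A \<approx> A,
      subst_ty' (comp' \<sigma> \<tau>) A \<approx> subst_ty' \<sigma> (subst_ty' \<tau> A),
      ctxof_ty' (subst_ty' \<sigma> A) \<approx> dom' \<sigma>,

      subst_tm' (id' (ctxof_tm' a)) a \<approx> a,
      subst_tm' (comp' \<sigma> \<tau>) a \<approx> subst_tm' \<sigma> (subst_tm' \<tau> a),
      ctxof_tm' (subst_tm' \<sigma> a) \<approx> dom' \<sigma>,

      ctxof_ty' (typeof' a) \<approx> ctxof_tm' a,
      typeof' (subst_tm' \<sigma> a) \<approx> subst_ty' \<sigma> (typeof' a),

      dom' (proj' A) \<approx> cext' A,
      cod' (proj' A) \<approx> ctxof_ty' A,
      ctxof_tm' (var' A) \<approx> cext' A,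
      typeof' (var' A) \<approx> subst_ty' (proj' A) A,
      dom' (indsub' \<sigma> a A) \<approx> dom' \<sigma>,
      cod' (indsub' \<sigma> a A) \<approx> cext' A,
      comp' (indsub' \<sigma> a A) (proj' A) \<approx> \<sigma>,
      subst_tm' (indsub' \<sigma> a A) (var' A) \<approx> a,
      indsub' (comp' \<sigma> (proj' A)) (subst_tm' \<sigma> (var' A)) A \<approx> \<sigma>])"

definition T_NM :: "(nm_sort, nm_symbol) theory_pres" where
  "T_NM = \<lparr>arity = nm_arity, result = nm_result, dom_eqs = nm_dom_eqs, axioms = nm_axioms\<rparr>"

lemma ess_alg_theory_T_NM: "ess_alg_theory T_NM"
  unfolding ess_alg_theory_def
proof (intro conjI allI)
  fix f
  show "\<forall>e \<in> set (dom_eqs T_NM f). well_sorted_eq T_NM e \<and>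
        (\<forall>(s, i) \<in> vars (fst e) \<union> vars (snd e).
           i < length (arity T_NM f) \<and> s = arity T_NM f ! i)"
    by (cases f) (simp_all add: T_NM_def well_sorted_eq_def)
next
  show "\<forall>e \<in> set (axioms T_NM). well_sorted_eq T_NM e"
    by (simp add: T_NM_def nm_axioms_def well_sorted_eq_def Let_def)
qed

text \<open>The axioms make \<open>t\<close> a family of arrows into \<open>\<diamond>\<close> natural in \<open>\<Gamma>\<close>, but \<open>\<diamond>\<close> is terminal only if
  moreover \<open>t\<^sub>\<diamond> = id\<^sub>\<diamond>\<close>.  This equation is not a consequence of the axioms: the monoid
  generated by an idempotent, viewed as a category with one object, is a countermodel.\<close>

definition esub_empty :: "(nm_sort, nm_symbol) equation" where
  "esub_empty = (esub' empty' \<approx> id' empty')"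

definition idem_model :: "(nm_sort, nm_symbol, bool) interp" where
  "idem_model =
     \<lparr>carrier = (\<lambda>s. case s of Ctx \<Rightarrow> {True} | Sub \<Rightarrow> UNIV | Type \<Rightarrow> {} | Term \<Rightarrow> {}),
      oper = (\<lambda>f xs. case f of
          DOM \<Rightarrow> (if length xs = 1 then Some True else None)
        | COD \<Rightarrow> (if length xs = 1 then Some True else None)
        | ID \<Rightarrow> (if xs = [True] then Some True else None)
        | EMPTY \<Rightarrow> (if xs = [] then Some True else None)
        | ESUB \<Rightarrow> (if xs = [True] then Some False else None)
        | COMP \<Rightarrow> (if length xs = 2 then Some (xs ! 0 \<and> xs ! 1) else None)
        | _ \<Rightarrow> None)\<rparr>"

lemma esub_empty_independent: "eat_model T_NM idem_model \<and> \<not> satisfies idem_model esub_empty"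
proof
  have "dom (oper idem_model f) =
          {xs \<in> listset (map (carrier idem_model) (arity T_NM f)).
             \<forall>e \<in> set (dom_eqs T_NM f). holds idem_model (\<lambda>s i. xs ! i) e}" for f
    by (cases f)
       (auto simp: idem_model_def T_NM_def holds_def set_Cons_def dom_def length_Suc_conv
          numeral_2_eq_2 split: if_splits)
  moreover have "ran (oper idem_model f) \<subseteq> carrier idem_model (result T_NM f)" for f
    by (cases f) (auto simp: idem_model_def T_NM_def ran_def split: if_splits)
  moreover have "\<forall>e \<in> set (axioms T_NM). satisfies idem_model e"
    by (simp add: T_NM_def nm_axioms_def Let_def satisfies_def idem_model_def)
  ultimately show "eat_model T_NM idem_model"
    by (simp add: eat_model_def)
  show "\<not> satisfies idem_model esub_empty"
    by (simp add: satisfies_def esub_empty_def idem_model_def ex_bool_eq)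
qed

section \<open>Small categories and presheaves\<close>

text \<open>The objects and morphisms of a small category, and the elements of the presheaves on it, are
  drawn from one type \<open>'u\<close>, whose subsets play the role of small sets.\<close>

record 'u category =
  Ob :: "'u set"
  Arr :: "'u set"
  Dom :: "'u \<Rightarrow> 'u"
  Cod :: "'u \<Rightarrow> 'u"
  Ident :: "'u \<Rightarrow> 'u"
  Comp :: "'u \<Rightarrow> 'u \<Rightarrow> 'u"   \<comment> \<open>\<open>Comp C g f\<close> is \<open>g \<circ> f\<close>\<close>

definition Hom :: "'u category \<Rightarrow> 'u \<Rightarrow> 'u \<Rightarrow> 'u set" where
  "Hom C X Y = {f \<in> Arr C. Dom C f = X \<and> Cod C f = Y}"

definition small_category :: "'u category \<Rightarrow> bool" where
  "small_category C \<longleftrightarrow>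
     (\<forall>f \<in> Arr C. Dom C f \<in> Ob C \<and> Cod C f \<in> Ob C) \<and>
     (\<forall>X \<in> Ob C. Ident C X \<in> Hom C X X) \<and>
     (\<forall>f \<in> Arr C. \<forall>g \<in> Arr C. Cod C f = Dom C g \<longrightarrow> Comp C g f \<in> Hom C (Dom C f) (Cod C g)) \<and>
     (\<forall>f \<in> Arr C. Comp C f (Ident C (Dom C f)) = f \<and> Comp C (Ident C (Cod C f)) f = f) \<and>
     (\<forall>f \<in> Arr C. \<forall>g \<in> Arr C. \<forall>h \<in> Arr C. Cod C f = Dom C g \<and> Cod C g = Dom C h \<longrightarrow>
        Comp C (Comp C h g) f = Comp C h (Comp C g f))"

definition terminal :: "'u category \<Rightarrow> 'u \<Rightarrow> bool" where
  "terminal C T \<longleftrightarrow> T \<in> Ob C \<and> (\<forall>X \<in> Ob C. \<exists>!f. f \<in> Hom C X T)"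

record 'u psh =
  sec :: "'u \<Rightarrow> 'u set"
  act :: "'u \<Rightarrow> 'u \<Rightarrow> 'u"   \<comment> \<open>\<open>act P f\<close> maps \<open>sec P (Cod C f)\<close> to \<open>sec P (Dom C f)\<close>\<close>

definition presheaf :: "'u category \<Rightarrow> 'u psh \<Rightarrow> bool" where
  "presheaf C P \<longleftrightarrow>
     (\<forall>f \<in> Arr C. \<forall>x \<in> sec P (Cod C f). act P f x \<in> sec P (Dom C f)) \<and>
     (\<forall>X \<in> Ob C. \<forall>x \<in> sec P X. act P (Ident C X) x = x) \<and>
     (\<forall>f \<in> Arr C. \<forall>g \<in> Arr C. Cod C f = Dom C g \<longrightarrow>
        (\<forall>x \<in> sec P (Cod C g). act P (Comp C g f) x = act P f (act P g x)))"

text \<open>A natural transformation is given by its components; the values of a component outside the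
  set of sections are irrelevant, hence the relation \<open>nat_eq\<close>.\<close>

type_synonym 'u psh_map = "'u \<Rightarrow> 'u \<Rightarrow> 'u"

definition nat_trans :: "'u category \<Rightarrow> 'u psh \<Rightarrow> 'u psh \<Rightarrow> 'u psh_map \<Rightarrow> bool" where
  "nat_trans C P Q \<alpha> \<longleftrightarrow>
     (\<forall>X \<in> Ob C. \<forall>x \<in> sec P X. \<alpha> X x \<in> sec Q X) \<and>
     (\<forall>f \<in> Arr C. \<forall>x \<in> sec P (Cod C f). \<alpha> (Dom C f) (act P f x) = act Q f (\<alpha> (Cod C f) x))"

definition nat_eq :: "'u category \<Rightarrow> 'u psh \<Rightarrow> 'u psh_map \<Rightarrow> 'u psh_map \<Rightarrow> bool" where
  "nat_eq C P \<alpha> \<beta> \<longleftrightarrow> (\<forall>X \<in> Ob C. \<forall>x \<in> sec P X. \<alpha> X x = \<beta> X x)"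

definition nat_comp :: "'u psh_map \<Rightarrow> 'u psh_map \<Rightarrow> 'u psh_map" where
  "nat_comp \<beta> \<alpha> = (\<lambda>X x. \<beta> X (\<alpha> X x))"

text \<open>A commutative square \<open>r \<circ> t = b \<circ> l\<close> (top \<open>t\<close>, left \<open>l\<close>, right \<open>r\<close>,
  bottom \<open>b\<close>) of presheaves which is a pullback in the
  presheaf category.\<close>

definition pullback_square ::
    "'u category \<Rightarrow> 'u psh \<Rightarrow> 'u psh \<Rightarrow> 'u psh \<Rightarrow> 'u psh \<Rightarrow>
     'u psh_map \<Rightarrow> 'u psh_map \<Rightarrow> 'u psh_map \<Rightarrow> 'u psh_map \<Rightarrow> bool" where
  "pullback_square C P Q R S t l r b \<longleftrightarrow>
     presheaf C P \<and> presheaf C Q \<and> presheaf C R \<and> presheaf C S \<and>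
     nat_trans C P Q t \<and> nat_trans C P R l \<and> nat_trans C Q S r \<and> nat_trans C R S b \<and>
     nat_eq C P (nat_comp r t) (nat_comp b l) \<and>
     (\<forall>Z \<alpha> \<beta>. presheaf C Z \<and> nat_trans C Z Q \<alpha> \<and> nat_trans C Z R \<beta> \<and>
        nat_eq C Z (nat_comp r \<alpha>) (nat_comp b \<beta>) \<longrightarrow>
        (\<exists>\<omega>. nat_trans C Z P \<omega> \<and>
             nat_eq C Z (nat_comp t \<omega>) \<alpha> \<and> nat_eq C Z (nat_comp l \<omega>) \<beta> \<and>
             (\<forall>\<omega>'. nat_trans C Z P \<omega>' \<and>
                   nat_eq C Z (nat_comp t \<omega>') \<alpha> \<and> nat_eq C Z (nat_comp l \<omega>') \<beta> \<longrightarrow>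
                   nat_eq C Z \<omega>' \<omega>)))"

definition yo :: "'u category \<Rightarrow> 'u \<Rightarrow> 'u psh" where
  "yo C X = \<lparr>sec = (\<lambda>Y. Hom C Y X), act = (\<lambda>f g. Comp C g f)\<rparr>"

definition yo_map :: "'u category \<Rightarrow> 'u \<Rightarrow> 'u psh_map" where
  "yo_map C f = (\<lambda>Y g. Comp C f g)"

text \<open>The map \<open>yo C X \<rightarrow> P\<close> corresponding to an element of \<open>sec P X\<close>.\<close>

definition elem_map :: "'u psh \<Rightarrow> 'u \<Rightarrow> 'u psh_map" where
  "elem_map P x = (\<lambda>Y f. act P f x)"

section \<open>Natural models\<close>

text \<open>The operations of context extension take the context \<open>\<Gamma>\<close> as an argument besides
  \<open>A \<in> sec (Ty N) \<Gamma>\<close>, because the sets of sections at different contexts may overlap.\<close>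

record 'u nat_model =
  Base :: "'u category"
  Emp :: "'u"
  Ty :: "'u psh"
  Tm :: "'u psh"
  Typing :: "'u psh_map"
  Ext :: "'u \<Rightarrow> 'u \<Rightarrow> 'u"
  Proj :: "'u \<Rightarrow> 'u \<Rightarrow> 'u"
  Gen :: "'u \<Rightarrow> 'u \<Rightarrow> 'u"

definition natural_model :: "'u nat_model \<Rightarrow> bool" where
  "natural_model N \<longleftrightarrow>
     small_category (Base N) \<and> terminal (Base N) (Emp N) \<and>
     presheaf (Base N) (Ty N) \<and> presheaf (Base N) (Tm N) \<and>
     nat_trans (Base N) (Tm N) (Ty N) (Typing N) \<and>
     (\<forall>\<Gamma> \<in> Ob (Base N). \<forall>A \<in> sec (Ty N) \<Gamma>.
        Ext N \<Gamma> A \<in> Ob (Base N) \<and>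
        Proj N \<Gamma> A \<in> Hom (Base N) (Ext N \<Gamma> A) \<Gamma> \<and>
        Gen N \<Gamma> A \<in> sec (Tm N) (Ext N \<Gamma> A) \<and>
        pullback_square (Base N)
          (yo (Base N) (Ext N \<Gamma> A)) (Tm N) (yo (Base N) \<Gamma>) (Ty N)
          (elem_map (Tm N) (Gen N \<Gamma> A)) (yo_map (Base N) (Proj N \<Gamma> A))
          (Typing N) (elem_map (Ty N) A))"

text \<open>An isomorphism of natural models: an isomorphism \<open>(F, G)\<close> of the base categories together with
  isomorphisms of the presheaves over it, preserving all the structure.\<close>

definition nat_model_iso :: "'u nat_model \<Rightarrow> 'v nat_model \<Rightarrow> bool" where
  "nat_model_iso N N' \<longleftrightarrow>
     (let C = Base N; C' = Base N' in
      \<exists>F G \<phi> \<psi>.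
        bij_betw F (Ob C) (Ob C') \<and> bij_betw G (Arr C) (Arr C') \<and>
        (\<forall>f \<in> Arr C. Dom C' (G f) = F (Dom C f) \<and> Cod C' (G f) = F (Cod C f)) \<and>
        (\<forall>\<Gamma> \<in> Ob C. G (Ident C \<Gamma>) = Ident C' (F \<Gamma>)) \<and>
        (\<forall>f \<in> Arr C. \<forall>g \<in> Arr C. Cod C f = Dom C g \<longrightarrow> G (Comp C g f) = Comp C' (G g) (G f)) \<and>
        F (Emp N) = Emp N' \<and>
        (\<forall>\<Gamma> \<in> Ob C. bij_betw (\<phi> \<Gamma>) (sec (Ty N) \<Gamma>) (sec (Ty N') (F \<Gamma>))) \<and>
        (\<forall>\<Gamma> \<in> Ob C. bij_betw (\<psi> \<Gamma>) (sec (Tm N) \<Gamma>) (sec (Tm N') (F \<Gamma>))) \<and>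
        (\<forall>f \<in> Arr C. \<forall>A \<in> sec (Ty N) (Cod C f).
           \<phi> (Dom C f) (act (Ty N) f A) = act (Ty N') (G f) (\<phi> (Cod C f) A)) \<and>
        (\<forall>f \<in> Arr C. \<forall>a \<in> sec (Tm N) (Cod C f).
           \<psi> (Dom C f) (act (Tm N) f a) = act (Tm N') (G f) (\<psi> (Cod C f) a)) \<and>
        (\<forall>\<Gamma> \<in> Ob C. \<forall>a \<in> sec (Tm N) \<Gamma>.
           \<phi> \<Gamma> (Typing N \<Gamma> a) = Typing N' (F \<Gamma>) (\<psi> \<Gamma> a)) \<and>
        (\<forall>\<Gamma> \<in> Ob C. \<forall>A \<in> sec (Ty N) \<Gamma>.
           F (Ext N \<Gamma> A) = Ext N' (F \<Gamma>) (\<phi> \<Gamma> A) \<and>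
           G (Proj N \<Gamma> A) = Proj N' (F \<Gamma>) (\<phi> \<Gamma> A) \<and>
           \<psi> (Ext N \<Gamma> A) (Gen N \<Gamma> A) = Gen N' (F \<Gamma>) (\<phi> \<Gamma> A)))"

section \<open>Passing between models of the theory and natural models\<close>

abbreviation op_val :: "('s, 'f, 'u) interp \<Rightarrow> 'f \<Rightarrow> 'u list \<Rightarrow> 'u" where
  "op_val M f xs \<equiv> the (oper M f xs)"

definition nat_model_of :: "(nm_sort, nm_symbol, 'u) interp \<Rightarrow> 'u nat_model" where
  "nat_model_of M =
     \<lparr>Base =
        \<lparr>Ob = carrier M Ctx, Arr = carrier M Sub,
         Dom = (\<lambda>\<sigma>. op_val M DOM [\<sigma>]), Cod = (\<lambda>\<sigma>. op_val M COD [\<sigma>]),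
         Ident = (\<lambda>\<Gamma>. op_val M ID [\<Gamma>]), Comp = (\<lambda>\<tau> \<sigma>. op_val M COMP [\<sigma>, \<tau>])\<rparr>,
      Emp = op_val M EMPTY [],
      Ty =
        \<lparr>sec = (\<lambda>\<Gamma>. {A \<in> carrier M Type. op_val M CTXOF_TY [A] = \<Gamma>}),
         act = (\<lambda>\<sigma> A. op_val M SUBST_TY [\<sigma>, A])\<rparr>,
      Tm =
        \<lparr>sec = (\<lambda>\<Gamma>. {a \<in> carrier M Term. op_val M CTXOF_TM [a] = \<Gamma>}),
         act = (\<lambda>\<sigma> a. op_val M SUBST_TM [\<sigma>, a])\<rparr>,
      Typing = (\<lambda>\<Gamma> a. op_val M TYPEOF [a]),
      Ext = (\<lambda>\<Gamma> A. op_val M CEXT [A]),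
      Proj = (\<lambda>\<Gamma> A. op_val M PROJ [A]),
      Gen = (\<lambda>\<Gamma> A. op_val M VAR [A])\<rparr>"

text \<open>In the opposite direction, types and terms are tagged with their contexts, so that the carrier
  of \<open>Type\<close> is the disjoint union of the sets \<open>sec (Ty N) \<Gamma>\<close>.\<close>

datatype 'u nm_elem = CtxE 'u | SubE 'u | TypeE 'u 'u | TermE 'u 'u

fun nm_carrier :: "'u nat_model \<Rightarrow> nm_sort \<Rightarrow> 'u nm_elem set" where
  "nm_carrier N Ctx = CtxE ` Ob (Base N)"
| "nm_carrier N Sub = SubE ` Arr (Base N)"
| "nm_carrier N Type = {TypeE \<Gamma> A | \<Gamma> A. \<Gamma> \<in> Ob (Base N) \<and> A \<in> sec (Ty N) \<Gamma>}"
| "nm_carrier N Term = {TermE \<Gamma> a | \<Gamma> a. \<Gamma> \<in> Ob (Base N) \<and> a \<in> sec (Tm N) \<Gamma>}"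

definition nm_oper :: "'u nat_model \<Rightarrow> nm_symbol \<Rightarrow> 'u nm_elem list \<Rightarrow> 'u nm_elem option" where
  "nm_oper N f xs =
    (let C = Base N in
     if xs \<notin> listset (map (nm_carrier N) (nm_arity f)) then None
     else case (f, xs) of
       (DOM, [SubE \<sigma>]) \<Rightarrow> Some (CtxE (Dom C \<sigma>))
     | (COD, [SubE \<sigma>]) \<Rightarrow> Some (CtxE (Cod C \<sigma>))
     | (ID, [CtxE \<Gamma>]) \<Rightarrow> Some (SubE (Ident C \<Gamma>))
     | (EMPTY, []) \<Rightarrow> Some (CtxE (Emp N))
     | (ESUB, [CtxE \<Gamma>]) \<Rightarrow> Some (SubE (THE f. f \<in> Hom C \<Gamma> (Emp N)))
     | (TYPEOF, [TermE \<Gamma> a]) \<Rightarrow> Some (TypeE \<Gamma> (Typing N \<Gamma> a))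
     | (CTXOF_TY, [TypeE \<Gamma> A]) \<Rightarrow> Some (CtxE \<Gamma>)
     | (CTXOF_TM, [TermE \<Gamma> a]) \<Rightarrow> Some (CtxE \<Gamma>)
     | (CEXT, [TypeE \<Gamma> A]) \<Rightarrow> Some (CtxE (Ext N \<Gamma> A))
     | (PROJ, [TypeE \<Gamma> A]) \<Rightarrow> Some (SubE (Proj N \<Gamma> A))
     | (VAR, [TypeE \<Gamma> A]) \<Rightarrow> Some (TermE (Ext N \<Gamma> A) (Gen N \<Gamma> A))
     | (COMP, [SubE \<sigma>, SubE \<tau>]) \<Rightarrow>
         if Cod C \<sigma> = Dom C \<tau> then Some (SubE (Comp C \<tau> \<sigma>)) else None
     | (SUBST_TY, [SubE \<sigma>, TypeE \<Gamma> A]) \<Rightarrow>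
         if \<Gamma> = Cod C \<sigma> then Some (TypeE (Dom C \<sigma>) (act (Ty N) \<sigma> A)) else None
     | (SUBST_TM, [SubE \<sigma>, TermE \<Gamma> a]) \<Rightarrow>
         if \<Gamma> = Cod C \<sigma> then Some (TermE (Dom C \<sigma>) (act (Tm N) \<sigma> a)) else None
     | (INDSUB, [SubE \<sigma>, TermE \<Delta> a, TypeE \<Gamma> A]) \<Rightarrow>
         if Cod C \<sigma> = \<Gamma> \<and> \<Delta> = Dom C \<sigma> \<and> Typing N \<Delta> a = act (Ty N) \<sigma> A
         then Some (SubE (THE h. h \<in> Hom C \<Delta> (Ext N \<Gamma> A) \<and>
                            Comp C (Proj N \<Gamma> A) h = \<sigma> \<and> act (Tm N) h (Gen N \<Gamma> A) = a))
         else None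
     | _ \<Rightarrow> None)"

definition model_of :: "'u nat_model \<Rightarrow> (nm_sort, nm_symbol, 'u nm_elem) interp" where
  "model_of N = \<lparr>carrier = nm_carrier N, oper = nm_oper N\<rparr>"

end

theory Submission
  imports Defs
begin

text \<open>A map out of a representable presheaf is an element, so the pullback condition on
  \<open>\<Gamma> \<cdot> A\<close> says exactly that every pair \<open>(\<sigma>, a)\<close> with \<open>typeof a = A[\<sigma>]\<close> is
  \<open>(p\<^sub>A \<circ> h, q\<^sub>A[h])\<close> for a unique \<open>h\<close>; this \<open>h\<close> is \<open>\<langle>\<sigma>, a\<rangle>\<^sub>A\<close>, and the last
  three axioms of the theory express its existence and uniqueness. Likewise \<open>t\<close> is determined by terminality, so
  the operations \<open>t\<close> and \<open>\<langle>_, _\<rangle>\<close> are preserved by any isomorphism of the remaining structure.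
  Once \<open>model_of (nat_model_of M)\<close> is known to be isomorphic to \<open>M\<close> and \<open>model_of\<close> to
  preserve and reflect isomorphism, the claims about \<open>nat_model_of (model_of N)\<close> and about \<open>nat_model_of\<close> on
  isomorphisms are formal.\<close>

section \<open>Isomorphisms of models of an essentially algebraic theory\<close>

lemma Cons_in_listset_iff [simp]: "x # xs \<in> listset (A # As) \<longleftrightarrow> x \<in> A \<and> xs \<in> listset As"
  by (simp add: set_Cons_def)

lemma in_listset_Cons_iff: "xs \<in> listset (A # As) \<longleftrightarrow> (\<exists>y ys. xs = y # ys \<and> y \<in> A \<and> ys \<in> listset As)"
  by (auto simp: set_Cons_def)

text \<open>Unfolding \<open>listset (A # As)\<close> to \<open>set_Cons\<close> would destroy the
  left-hand side of \<open>Cons_in_listset_iff\<close> before that rule can fire.\<close>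

declare listset.simps(2) [simp del]

lemma map2_in_listset:
  assumes "\<And>s. h s ` carrier M s \<subseteq> carrier M' s" "xs \<in> listset (map (carrier M) ss)"
  shows "map2 h ss xs \<in> listset (map (carrier M') ss)"
  using assms(2)
proof (induction ss arbitrary: xs)
  case (Cons s ss)
  then show ?case using assms(1) by (fastforce simp: in_listset_Cons_iff)
qed simp

text \<open>The free \<open>g\<close> covers two uses: the identity at every sort when
  \<open>k\<close> inverts \<open>h\<close>, and \<open>k s \<circ> h s\<close> when isomorphisms
  are composed.\<close>

lemma map2_cancel:
  assumes "\<And>s x. x \<in> carrier M s \<Longrightarrow> k s (h s x) = g s x" "xs \<in> listset (map (carrier M) ss)"
  shows "map2 k ss (map2 h ss xs) = map2 g ss xs"
  using assms(2)
proof (induction ss arbitrary: xs)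
  case (Cons s ss)
  then show ?case using assms(1) by (auto simp: in_listset_Cons_iff)
qed simp

text \<open>\<open>map2\<close> truncates to the shorter list; membership in \<open>listset\<close>
  forces \<open>xs\<close> to have the length of \<open>ss\<close>.\<close>

lemma map2_ident:
  assumes "xs \<in> listset (map (carrier M) ss)"
  shows "map2 (\<lambda>s x. x) ss xs = xs"
  using assms by (induction ss arbitrary: xs) (auto simp: in_listset_Cons_iff)

lemma eat_model_closed:
  assumes "eat_model T M" "oper M f xs = Some y"
  shows "y \<in> carrier M (result T f)"
  using assms unfolding eat_model_def by (blast intro: ranI)

text \<open>The sortwise inverses form a homomorphism because the values of the operations of
  \<open>M\<close> lie in its carriers, where \<open>k\<close> undoes \<open>h\<close>;
  \<open>eat_model T M\<close> supplies this closure.\<close>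

lemma model_iso_sym:
  assumes M: "eat_model T M" and iso: "model_iso T M M'"
  shows "model_iso T M' M"
proof -
  obtain h where bij: "\<And>s. bij_betw (h s) (carrier M s) (carrier M' s)"
    and hom: "\<And>f xs. xs \<in> listset (map (carrier M) (arity T f)) \<Longrightarrow>
        oper M' f (map2 h (arity T f) xs) = map_option (h (result T f)) (oper M f xs)"
    using iso by (auto simp: model_iso_def)
  define k where "k s = inv_into (carrier M s) (h s)" for s
  have k: "bij_betw (k s) (carrier M' s) (carrier M s)" for s
    using bij by (simp add: k_def bij_betw_inv_into)
  have hk: "h s (k s y) = y" if "y \<in> carrier M' s" for s y
    using bij_betw_inv_into_right[OF bij that] by (simp add: k_def)
  have kh: "k s (h s x) = x" if "x \<in> carrier M s" for s x
    using bij_betw_inv_into_left[OF bij that] by (simp add: k_def)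
  have "oper M f (map2 k (arity T f) ys) = map_option (k (result T f)) (oper M' f ys)"
    if ys: "ys \<in> listset (map (carrier M') (arity T f))" for f ys
  proof -
    let ?xs = "map2 k (arity T f) ys"
    have xs: "?xs \<in> listset (map (carrier M) (arity T f))"
      using k ys by (intro map2_in_listset[of k M' M]) (auto simp: bij_betw_def)
    have "map2 h (arity T f) ?xs = ys"
      using map2_cancel[of M' h k "\<lambda>s x. x", OF _ ys] hk map2_ident[OF ys] by simp
    with hom[OF xs] have "oper M' f ys = map_option (h (result T f)) (oper M f ?xs)"
      by simp
    then show ?thesis
      using eat_model_closed[OF M] kh by (cases "oper M f ?xs") auto
  qed
  with k show ?thesis
    unfolding model_iso_def by blast
qed

lemma model_iso_trans:
  assumes iso: "model_iso T M M'" and iso': "model_iso T M' M''"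
  shows "model_iso T M M''"
proof -
  obtain h where bij: "\<And>s. bij_betw (h s) (carrier M s) (carrier M' s)"
    and hom: "\<And>f xs. xs \<in> listset (map (carrier M) (arity T f)) \<Longrightarrow>
        oper M' f (map2 h (arity T f) xs) = map_option (h (result T f)) (oper M f xs)"
    using iso by (auto simp: model_iso_def)
  obtain h' where bij': "\<And>s. bij_betw (h' s) (carrier M' s) (carrier M'' s)"
    and hom': "\<And>f xs. xs \<in> listset (map (carrier M') (arity T f)) \<Longrightarrow>
        oper M'' f (map2 h' (arity T f) xs) = map_option (h' (result T f)) (oper M' f xs)"
    using iso' by (auto simp: model_iso_def)
  have "oper M'' f (map2 (\<lambda>s. h' s \<circ> h s) (arity T f) xs)
      = map_option (h' (result T f) \<circ> h (result T f)) (oper M f xs)"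
    if xs: "xs \<in> listset (map (carrier M) (arity T f))" for f xs
  proof -
    have "map2 h (arity T f) xs \<in> listset (map (carrier M') (arity T f))"
      using bij xs by (intro map2_in_listset[of h M M']) (auto simp: bij_betw_def)
    from hom'[OF this] hom[OF xs]
      map2_cancel[where M = M and k = h' and h = h and g = "\<lambda>s. h' s \<circ> h s", OF _ xs]
    show ?thesis
      by (simp add: option.map_comp)
  qed
  moreover have "bij_betw (h' s \<circ> h s) (carrier M s) (carrier M'' s)" for s
    using bij bij' by (rule bij_betw_trans)
  ultimately show ?thesis
    unfolding model_iso_def by (intro exI[of _ "\<lambda>s. h' s \<circ> h s"]) blast
qed

section \<open>Pullbacks of representable presheaves\<close>

lemma Hom_iff: "f \<in> Hom C X Y \<longleftrightarrow> f \<in> Arr C \<and> Dom C f = X \<and> Cod C f = Y"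
  by (simp add: Hom_def)

lemma comp_assoc:
  assumes "small_category C" "f \<in> Arr C" "g \<in> Arr C" "h \<in> Arr C"
    "Cod C f = Dom C g" "Cod C g = Dom C h"
  shows "Comp C (Comp C h g) f = Comp C h (Comp C g f)"
  using assms by (simp add: small_category_def)

lemma presheaf_yo:
  assumes "small_category C" "X \<in> Ob C"
  shows "presheaf C (yo C X)"
  using assms by (auto simp: presheaf_def yo_def small_category_def Hom_iff)

lemma nat_trans_yo_map:
  assumes "small_category C" "f \<in> Hom C X Y"
  shows "nat_trans C (yo C X) (yo C Y) (yo_map C f)"
  using assms by (auto simp: nat_trans_def yo_def yo_map_def small_category_def Hom_iff)

lemma nat_trans_elem_map:
  assumes "small_category C" "presheaf C P" "x \<in> sec P X"
  shows "nat_trans C (yo C X) P (elem_map P x)"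
  using assms by (auto simp: nat_trans_def yo_def elem_map_def presheaf_def small_category_def Hom_iff)

text \<open>By the Yoneda lemma it suffices to test the universal property on representables.\<close>

lemma pullback_square_representable_iff:
  assumes C: "small_category C" and X: "X \<in> Ob C" and Y: "Y \<in> Ob C"
    and Q: "presheaf C Q" and R: "presheaf C R" and r: "nat_trans C Q R r"
    and p: "p \<in> Hom C Y X" and q: "q \<in> sec Q Y" and A: "A \<in> sec R X"
  shows "pullback_square C (yo C Y) Q (yo C X) R (elem_map Q q) (yo_map C p) r (elem_map R A) \<longleftrightarrow>
    r Y q = act R p A \<and>
    (\<forall>W \<in> Ob C. \<forall>\<sigma> \<in> Hom C W X. \<forall>a \<in> sec Q W. r W a = act R \<sigma> A \<longrightarrow>
      (\<exists>!h. h \<in> Hom C W Y \<and> Comp C p h = \<sigma> \<and> act Q h q = a))"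
    (is "?L \<longleftrightarrow> ?comm \<and> ?univ")
proof
  assume L: ?L
  have pA: "Comp C p (Ident C Y) = p" "act Q (Ident C Y) q = q" "Ident C Y \<in> Hom C Y Y"
    using C Q Y p q by (auto simp: small_category_def presheaf_def Hom_iff)
  have "nat_eq C (yo C Y) (nat_comp r (elem_map Q q)) (nat_comp (elem_map R A) (yo_map C p))"
    using L by (simp add: pullback_square_def)
  \<comment> \<open>The commuting square is evaluated at the identity of \<open>Y\<close>, the
    universal element of \<open>yo C Y\<close>.\<close>
  with Y pA have ?comm
    by (fastforce simp: nat_eq_def nat_comp_def elem_map_def yo_map_def yo_def)
  moreover have ?univ
  proof (intro ballI impI)
    fix W \<sigma> a
    assume W: "W \<in> Ob C" and \<sigma>: "\<sigma> \<in> Hom C W X" and a: "a \<in> sec Q W" and ra: "r W a = act R \<sigma> A"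
    have id: "Comp C \<sigma> (Ident C W) = \<sigma>" "act Q (Ident C W) a = a" "Ident C W \<in> Hom C W W"
      using C Q W \<sigma> a by (auto simp: small_category_def presheaf_def Hom_iff)
    \<comment> \<open>By Yoneda the pair \<open>(\<sigma>, a)\<close> is a cone with vertex
      \<open>yo C W\<close>; it commutes because \<open>r\<close> is natural and
      \<open>r W a = act R \<sigma> A\<close>.\<close>
    have eq: "nat_eq C (yo C W) (nat_comp r (elem_map Q a)) (nat_comp (elem_map R A) (yo_map C \<sigma>))"
      using r R C a \<sigma> A ra
      by (auto simp: nat_eq_def nat_comp_def elem_map_def yo_map_def yo_def nat_trans_def presheaf_def
          Hom_iff)
    let ?fac = "\<lambda>\<omega>. nat_trans C (yo C W) (yo C Y) \<omega> \<and>
        nat_eq C (yo C W) (nat_comp (elem_map Q q) \<omega>) (elem_map Q a) \<and>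
        nat_eq C (yo C W) (nat_comp (yo_map C p) \<omega>) (yo_map C \<sigma>)"
    have "presheaf C (yo C W)" "nat_trans C (yo C W) Q (elem_map Q a)"
      "nat_trans C (yo C W) (yo C X) (yo_map C \<sigma>)"
      using C W Q a \<sigma> by (simp_all add: presheaf_yo nat_trans_elem_map nat_trans_yo_map)
    with L eq obtain \<omega> where \<omega>: "?fac \<omega>" and uniq: "\<And>\<omega>'. ?fac \<omega>' \<Longrightarrow> nat_eq C (yo C W) \<omega>' \<omega>"
      unfolding pullback_square_def by blast
    show "\<exists>!h. h \<in> Hom C W Y \<and> Comp C p h = \<sigma> \<and> act Q h q = a"
    \<comment> \<open>A map out of \<open>yo C W\<close> is determined by its value at the identity
      of \<open>W\<close>, so that value of the mediating map is the arrow sought.\<close>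
    proof (rule ex1I[of _ "\<omega> W (Ident C W)"])
      show "\<omega> W (Ident C W) \<in> Hom C W Y \<and> Comp C p (\<omega> W (Ident C W)) = \<sigma> \<and>
          act Q (\<omega> W (Ident C W)) q = a"
        using \<omega> W id by (auto simp: nat_trans_def nat_eq_def nat_comp_def elem_map_def yo_map_def yo_def)
    next
      fix h assume h: "h \<in> Hom C W Y \<and> Comp C p h = \<sigma> \<and> act Q h q = a"
      \<comment> \<open>A further solution \<open>h\<close> yields the mediating map
        \<open>yo_map C h\<close>; comparing the two mediating maps at the identity gives
        uniqueness.\<close>
      have "?fac (yo_map C h)"
        using h C Q p q nat_trans_yo_map[OF C, of h W Y]
        by (auto simp: nat_eq_def nat_comp_def elem_map_def yo_map_def yo_def presheaf_def
          small_category_def Hom_iff)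
      have "Comp C h (Ident C W) = h"
        using h C by (auto simp: small_category_def Hom_iff)
      with uniq[OF \<open>?fac (yo_map C h)\<close>] W id(3) show "h = \<omega> W (Ident C W)"
        by (auto simp: nat_eq_def yo_map_def yo_def)
    qed
  qed
  ultimately show "?comm \<and> ?univ" ..
next
  assume "?comm \<and> ?univ"
  then have comm: ?comm and univ: ?univ by auto
  show ?L
    unfolding pullback_square_def
  proof (intro conjI allI impI)
    show "nat_eq C (yo C Y) (nat_comp r (elem_map Q q)) (nat_comp (elem_map R A) (yo_map C p))"
      using comm r R p q A
      by (auto simp: nat_eq_def nat_comp_def elem_map_def yo_map_def yo_def nat_trans_def presheaf_def
          Hom_iff)
  next
    fix Z \<alpha> \<beta>
    assume "presheaf C Z \<and> nat_trans C Z Q \<alpha> \<and> nat_trans C Z (yo C X) \<beta> \<and>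
      nat_eq C Z (nat_comp r \<alpha>) (nat_comp (elem_map R A) \<beta>)"
    then have Z: "presheaf C Z" and \<alpha>: "nat_trans C Z Q \<alpha>" and \<beta>: "nat_trans C Z (yo C X) \<beta>"
      and eq: "nat_eq C Z (nat_comp r \<alpha>) (nat_comp (elem_map R A) \<beta>)"
      by auto
    \<comment> \<open>For an arbitrary \<open>Z\<close> the mediating map is built pointwise:
      \<open>P W z h\<close> says that \<open>h\<close> solves the problem posed by the pair
      \<open>(\<beta> W z, \<alpha> W z)\<close>.\<close>
    define P where "P W z h \<longleftrightarrow> h \<in> Hom C W Y \<and> Comp C p h = \<beta> W z \<and> act Q h q = \<alpha> W z" for W z h
    define \<omega> where "\<omega> W z = (THE h. P W z h)" for W z
    have ex1: "\<exists>!h. P W z h" if "W \<in> Ob C" "z \<in> sec Z W" for W z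
      using that univ \<alpha> \<beta> eq
      by (auto simp: P_def nat_trans_def nat_eq_def nat_comp_def elem_map_def yo_def)
    have \<omega>: "P W z (\<omega> W z)" if "W \<in> Ob C" "z \<in> sec Z W" for W z
      using theI'[OF ex1[OF that]] by (simp add: \<omega>_def)
    have uniq: "h = \<omega> W z" if "W \<in> Ob C" "z \<in> sec Z W" "P W z h" for W z h
      using ex1[OF that(1,2)] \<omega>[OF that(1,2)] that(3) by blast
    \<comment> \<open>Naturality follows from uniqueness: the solution at \<open>z\<close> composed
      with \<open>f\<close> solves the problem posed at \<open>act Z f z\<close>.\<close>
    have "\<omega> (Dom C f) (act Z f z) = Comp C (\<omega> (Cod C f) z) f"
      if f: "f \<in> Arr C" and z: "z \<in> sec Z (Cod C f)" for f z
    proof -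
      have ob: "Dom C f \<in> Ob C" "Cod C f \<in> Ob C" and fz: "act Z f z \<in> sec Z (Dom C f)"
        using C Z f z by (auto simp: small_category_def presheaf_def)
      have "\<beta> (Dom C f) (act Z f z) = Comp C (\<beta> (Cod C f) z) f"
        "\<alpha> (Dom C f) (act Z f z) = act Q f (\<alpha> (Cod C f) z)"
        using \<alpha> \<beta> f z by (auto simp: nat_trans_def yo_def)
      moreover have "Comp C (Comp C p (\<omega> (Cod C f) z)) f = Comp C p (Comp C (\<omega> (Cod C f) z) f)"
        using \<omega>[OF ob(2) z] f p by (intro comp_assoc[OF C]) (auto simp: P_def Hom_iff)
      ultimately have "P (Dom C f) (act Z f z) (Comp C (\<omega> (Cod C f) z) f)"
        using \<omega>[OF ob(2) z] C Q f q by (auto simp: P_def small_category_def presheaf_def Hom_iff)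
      from uniq[OF ob(1) fz this] show ?thesis by simp
    qed
    with \<omega> have nat: "nat_trans C Z (yo C Y) \<omega>"
      by (simp add: nat_trans_def yo_def P_def)
    show "\<exists>\<omega>. nat_trans C Z (yo C Y) \<omega> \<and>
        nat_eq C Z (nat_comp (elem_map Q q) \<omega>) \<alpha> \<and> nat_eq C Z (nat_comp (yo_map C p) \<omega>) \<beta> \<and>
        (\<forall>\<omega>'. nat_trans C Z (yo C Y) \<omega>' \<and> nat_eq C Z (nat_comp (elem_map Q q) \<omega>') \<alpha> \<and>
           nat_eq C Z (nat_comp (yo_map C p) \<omega>') \<beta> \<longrightarrow> nat_eq C Z \<omega>' \<omega>)"
    proof (intro exI[of _ \<omega>] conjI allI impI)
      fix \<omega>'
      assume *: "nat_trans C Z (yo C Y) \<omega>' \<and> nat_eq C Z (nat_comp (elem_map Q q) \<omega>') \<alpha> \<and>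
           nat_eq C Z (nat_comp (yo_map C p) \<omega>') \<beta>"
      show "nat_eq C Z \<omega>' \<omega>"
        unfolding nat_eq_def
      proof (intro ballI)
        fix W z assume Wz: "W \<in> Ob C" "z \<in> sec Z W"
        show "\<omega>' W z = \<omega> W z"
          by (rule uniq[OF Wz])
            (use * Wz in \<open>auto simp: P_def nat_trans_def nat_eq_def nat_comp_def elem_map_def
               yo_map_def yo_def\<close>)
      qed
    qed (use nat \<omega> in \<open>auto simp: P_def nat_eq_def nat_comp_def elem_map_def yo_map_def\<close>)
  qed (use assms in \<open>simp_all add: presheaf_yo nat_trans_elem_map nat_trans_yo_map\<close>)
qed

section \<open>The model of the theory given by a natural model\<close>

lemma those_simps [simp]:
  "those [] = Some []" "those (Some x # xs) = map_option ((#) x) (those xs)" "those (None # xs) = None"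
  by auto

text \<open>The arrow \<open>t\<close> of the theory. Naming it, like \<open>ext_pair\<close> below,
  keeps the definite descriptions in \<open>nm_oper\<close> away from the simplifier.\<close>

definition bang :: "'u nat_model \<Rightarrow> 'u \<Rightarrow> 'u" where
  "bang N \<Gamma> = (THE f. f \<in> Hom (Base N) \<Gamma> (Emp N))"

text \<open>The arrow written \<open>\<langle>\<sigma>, a\<rangle>\<close> in the theory. Its domain
  is taken from \<open>\<sigma>\<close>; in the clause for \<open>INDSUB\<close> this agrees with
  the context of \<open>a\<close>.\<close>

definition ext_pair :: "'u nat_model \<Rightarrow> 'u \<Rightarrow> 'u \<Rightarrow> 'u \<Rightarrow> 'u \<Rightarrow> 'u" where
  "ext_pair N \<Gamma> A \<sigma> a = (THE h. h \<in> Hom (Base N) (Dom (Base N) \<sigma>) (Ext N \<Gamma> A) \<and>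
     Comp (Base N) (Proj N \<Gamma> A) h = \<sigma> \<and> act (Tm N) h (Gen N \<Gamma> A) = a)"

text \<open>Evaluation on arguments with the right constructors, with carrier membership spelled out
  as conditions on the untagged data. Arguments outside the carriers are covered by
  \<open>nm_oper_eq_None\<close>.\<close>

lemma nm_oper_simps:
  "nm_oper N DOM [SubE \<sigma>] = (if \<sigma> \<in> Arr (Base N) then Some (CtxE (Dom (Base N) \<sigma>)) else None)"
  "nm_oper N COD [SubE \<sigma>] = (if \<sigma> \<in> Arr (Base N) then Some (CtxE (Cod (Base N) \<sigma>)) else None)"
  "nm_oper N ID [CtxE \<Gamma>] = (if \<Gamma> \<in> Ob (Base N) then Some (SubE (Ident (Base N) \<Gamma>)) else None)"
  "nm_oper N EMPTY [] = Some (CtxE (Emp N))"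
  "nm_oper N ESUB [CtxE \<Gamma>] = (if \<Gamma> \<in> Ob (Base N) then Some (SubE (bang N \<Gamma>)) else None)"
  "nm_oper N TYPEOF [TermE \<Gamma> a] = (if \<Gamma> \<in> Ob (Base N) \<and> a \<in> sec (Tm N) \<Gamma>
     then Some (TypeE \<Gamma> (Typing N \<Gamma> a)) else None)"
  "nm_oper N CTXOF_TY [TypeE \<Gamma> A] = (if \<Gamma> \<in> Ob (Base N) \<and> A \<in> sec (Ty N) \<Gamma>
     then Some (CtxE \<Gamma>) else None)"
  "nm_oper N CTXOF_TM [TermE \<Gamma> a] = (if \<Gamma> \<in> Ob (Base N) \<and> a \<in> sec (Tm N) \<Gamma>
     then Some (CtxE \<Gamma>) else None)"
  "nm_oper N CEXT [TypeE \<Gamma> A] = (if \<Gamma> \<in> Ob (Base N) \<and> A \<in> sec (Ty N) \<Gamma>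
     then Some (CtxE (Ext N \<Gamma> A)) else None)"
  "nm_oper N PROJ [TypeE \<Gamma> A] = (if \<Gamma> \<in> Ob (Base N) \<and> A \<in> sec (Ty N) \<Gamma>
     then Some (SubE (Proj N \<Gamma> A)) else None)"
  "nm_oper N VAR [TypeE \<Gamma> A] = (if \<Gamma> \<in> Ob (Base N) \<and> A \<in> sec (Ty N) \<Gamma>
     then Some (TermE (Ext N \<Gamma> A) (Gen N \<Gamma> A)) else None)"
  "nm_oper N COMP [SubE \<sigma>, SubE \<tau>] =
     (if \<sigma> \<in> Arr (Base N) \<and> \<tau> \<in> Arr (Base N) \<and> Cod (Base N) \<sigma> = Dom (Base N) \<tau>
      then Some (SubE (Comp (Base N) \<tau> \<sigma>)) else None)"
  "nm_oper N SUBST_TY [SubE \<sigma>, TypeE \<Gamma> A] =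
     (if \<sigma> \<in> Arr (Base N) \<and> \<Gamma> \<in> Ob (Base N) \<and> A \<in> sec (Ty N) \<Gamma> \<and> \<Gamma> = Cod (Base N) \<sigma>
      then Some (TypeE (Dom (Base N) \<sigma>) (act (Ty N) \<sigma> A)) else None)"
  "nm_oper N SUBST_TM [SubE \<sigma>, TermE \<Gamma> a] =
     (if \<sigma> \<in> Arr (Base N) \<and> \<Gamma> \<in> Ob (Base N) \<and> a \<in> sec (Tm N) \<Gamma> \<and> \<Gamma> = Cod (Base N) \<sigma>
      then Some (TermE (Dom (Base N) \<sigma>) (act (Tm N) \<sigma> a)) else None)"
  "nm_oper N INDSUB [SubE \<sigma>, TermE \<Delta> a, TypeE \<Gamma> A] =
     (if \<sigma> \<in> Arr (Base N) \<and> \<Delta> \<in> Ob (Base N) \<and> a \<in> sec (Tm N) \<Delta> \<and>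
         \<Gamma> \<in> Ob (Base N) \<and> A \<in> sec (Ty N) \<Gamma> \<and>
         Cod (Base N) \<sigma> = \<Gamma> \<and> \<Delta> = Dom (Base N) \<sigma> \<and> Typing N \<Delta> a = act (Ty N) \<sigma> A
      then Some (SubE (ext_pair N \<Gamma> A \<sigma> a)) else None)"
  by (auto simp: nm_oper_def bang_def ext_pair_def image_iff Let_def)

lemma nm_oper_eq_None: "xs \<notin> listset (map (nm_carrier N) (nm_arity f)) \<Longrightarrow> nm_oper N f xs = None"
  by (simp add: nm_oper_def)

section \<open>Structure of a natural model as rewrite rules\<close>

locale natural_model_structure =
  fixes N :: "'u nat_model"
  assumes natural_model: "natural_model N"
begin

abbreviation "C \<equiv> Base N"

lemma small: "small_category C"
  and ty_presheaf: "presheaf C (Ty N)"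
  and tm_presheaf: "presheaf C (Tm N)"
  and typing_nat_trans: "nat_trans C (Tm N) (Ty N) (Typing N)"
  and emp_terminal: "terminal C (Emp N)"
  using natural_model by (simp_all add: natural_model_def)

text \<open>The identity laws have premises \<open>Dom C f = X\<close> and
  \<open>Cod C f = X\<close> so that they also fire when the object is only provably equal to the
  domain or codomain.\<close>

lemma category_simps [simp]:
  "f \<in> Arr C \<Longrightarrow> Dom C f \<in> Ob C"
  "f \<in> Arr C \<Longrightarrow> Cod C f \<in> Ob C"
  "X \<in> Ob C \<Longrightarrow> Ident C X \<in> Arr C"
  "X \<in> Ob C \<Longrightarrow> Dom C (Ident C X) = X"
  "X \<in> Ob C \<Longrightarrow> Cod C (Ident C X) = X"
  "f \<in> Arr C \<Longrightarrow> g \<in> Arr C \<Longrightarrow> Cod C f = Dom C g \<Longrightarrow> Comp C g f \<in> Arr C"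
  "f \<in> Arr C \<Longrightarrow> g \<in> Arr C \<Longrightarrow> Cod C f = Dom C g \<Longrightarrow> Dom C (Comp C g f) = Dom C f"
  "f \<in> Arr C \<Longrightarrow> g \<in> Arr C \<Longrightarrow> Cod C f = Dom C g \<Longrightarrow> Cod C (Comp C g f) = Cod C g"
  "f \<in> Arr C \<Longrightarrow> Dom C f = X \<Longrightarrow> Comp C f (Ident C X) = f"
  "f \<in> Arr C \<Longrightarrow> Cod C f = X \<Longrightarrow> Comp C (Ident C X) f = f"
  "f \<in> Arr C \<Longrightarrow> g \<in> Arr C \<Longrightarrow> h \<in> Arr C \<Longrightarrow> Cod C f = Dom C g \<Longrightarrow> Cod C g = Dom C h \<Longrightarrow>
    Comp C (Comp C h g) f = Comp C h (Comp C g f)"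
  using small unfolding small_category_def Hom_iff by blast+

lemma presheaf_simps [simp]:
  "f \<in> Arr C \<Longrightarrow> A \<in> sec (Ty N) (Cod C f) \<Longrightarrow> act (Ty N) f A \<in> sec (Ty N) (Dom C f)"
  "X \<in> Ob C \<Longrightarrow> A \<in> sec (Ty N) X \<Longrightarrow> act (Ty N) (Ident C X) A = A"
  "f \<in> Arr C \<Longrightarrow> g \<in> Arr C \<Longrightarrow> Cod C f = Dom C g \<Longrightarrow> A \<in> sec (Ty N) (Cod C g) \<Longrightarrow>
    act (Ty N) (Comp C g f) A = act (Ty N) f (act (Ty N) g A)"
  "f \<in> Arr C \<Longrightarrow> a \<in> sec (Tm N) (Cod C f) \<Longrightarrow> act (Tm N) f a \<in> sec (Tm N) (Dom C f)"
  "X \<in> Ob C \<Longrightarrow> a \<in> sec (Tm N) X \<Longrightarrow> act (Tm N) (Ident C X) a = a"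
  "f \<in> Arr C \<Longrightarrow> g \<in> Arr C \<Longrightarrow> Cod C f = Dom C g \<Longrightarrow> a \<in> sec (Tm N) (Cod C g) \<Longrightarrow>
    act (Tm N) (Comp C g f) a = act (Tm N) f (act (Tm N) g a)"
  using ty_presheaf tm_presheaf unfolding presheaf_def by blast+

lemma typing_simps [simp]:
  "X \<in> Ob C \<Longrightarrow> a \<in> sec (Tm N) X \<Longrightarrow> Typing N X a \<in> sec (Ty N) X"
  "f \<in> Arr C \<Longrightarrow> a \<in> sec (Tm N) (Cod C f) \<Longrightarrow>
    Typing N (Dom C f) (act (Tm N) f a) = act (Ty N) f (Typing N (Cod C f) a)"
  using typing_nat_trans unfolding nat_trans_def by blast+

lemma ext_simps [simp]:
  assumes "X \<in> Ob C" "A \<in> sec (Ty N) X"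
  shows "Ext N X A \<in> Ob C" "Proj N X A \<in> Arr C" "Dom C (Proj N X A) = Ext N X A"
    "Cod C (Proj N X A) = X" "Gen N X A \<in> sec (Tm N) (Ext N X A)"
  using natural_model assms by (auto simp: natural_model_def Hom_iff)

lemma emp_in_Ob [simp]: "Emp N \<in> Ob C"
  using emp_terminal by (simp add: terminal_def)

lemma to_emp_unique:
  assumes "f \<in> Arr C" "g \<in> Arr C" "Dom C f = Dom C g" "Cod C f = Emp N" "Cod C g = Emp N"
  shows "f = g"
  using emp_terminal assms category_simps(1)[of f] unfolding terminal_def Hom_iff by metis

lemma bang_in_Hom:
  assumes "X \<in> Ob C"
  shows "bang N X \<in> Hom C X (Emp N)"
  using emp_terminal assms unfolding terminal_def bang_def by (metis (no_types, lifting) theI')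

lemma bang_simps [simp]:
  assumes "X \<in> Ob C"
  shows "bang N X \<in> Arr C" "Dom C (bang N X) = X" "Cod C (bang N X) = Emp N"
  using bang_in_Hom[OF assms] by (auto simp: Hom_iff)

lemma bang_eqI: "f \<in> Arr C \<Longrightarrow> Dom C f = X \<Longrightarrow> Cod C f = Emp N \<Longrightarrow> bang N X = f"
  by (rule to_emp_unique) auto

lemma comp_bang [simp]: "f \<in> Arr C \<Longrightarrow> Cod C f = X \<Longrightarrow> Comp C (bang N X) f = bang N (Dom C f)"
  by (rule to_emp_unique) auto

text \<open>The pullback clause of \<open>natural_model\<close>, read through
  \<open>pullback_square_representable_iff\<close>: first the commuting square, then the universal
  property on representables.\<close>

lemma ext_universal:
  assumes "X \<in> Ob C" "A \<in> sec (Ty N) X"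
  shows "Typing N (Ext N X A) (Gen N X A) = act (Ty N) (Proj N X A) A"
    and "\<sigma> \<in> Arr C \<Longrightarrow> Cod C \<sigma> = X \<Longrightarrow> a \<in> sec (Tm N) (Dom C \<sigma>) \<Longrightarrow>
      Typing N (Dom C \<sigma>) a = act (Ty N) \<sigma> A \<Longrightarrow>
      \<exists>!h. h \<in> Hom C (Dom C \<sigma>) (Ext N X A) \<and> Comp C (Proj N X A) h = \<sigma> \<and> act (Tm N) h (Gen N X A) = a"
proof -
  have *: "Typing N (Ext N X A) (Gen N X A) = act (Ty N) (Proj N X A) A \<and>
      (\<forall>W \<in> Ob C. \<forall>\<sigma> \<in> Hom C W X. \<forall>a \<in> sec (Tm N) W. Typing N W a = act (Ty N) \<sigma> A \<longrightarrow>
        (\<exists>!h. h \<in> Hom C W (Ext N X A) \<and> Comp C (Proj N X A) h = \<sigma> \<and> act (Tm N) h (Gen N X A) = a))"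
    using natural_model assms
    by (subst pullback_square_representable_iff[symmetric])
       (simp_all add: small ty_presheaf tm_presheaf typing_nat_trans Hom_iff natural_model_def)
  from * show "Typing N (Ext N X A) (Gen N X A) = act (Ty N) (Proj N X A) A" ..
  from * show "\<exists>!h. h \<in> Hom C (Dom C \<sigma>) (Ext N X A) \<and> Comp C (Proj N X A) h = \<sigma> \<and> act (Tm N) h (Gen N X A) = a"
    if "\<sigma> \<in> Arr C" "Cod C \<sigma> = X" "a \<in> sec (Tm N) (Dom C \<sigma>)"
      "Typing N (Dom C \<sigma>) a = act (Ty N) \<sigma> A"
    using that by (simp add: Hom_iff)
qed

declare ext_universal(1) [simp]

lemma ext_pair_simps [simp]:
  assumes "\<sigma> \<in> Arr C" "Cod C \<sigma> = X" "A \<in> sec (Ty N) X" "a \<in> sec (Tm N) (Dom C \<sigma>)"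
    "Typing N (Dom C \<sigma>) a = act (Ty N) \<sigma> A"
  shows "ext_pair N X A \<sigma> a \<in> Arr C" "Dom C (ext_pair N X A \<sigma> a) = Dom C \<sigma>"
    "Cod C (ext_pair N X A \<sigma> a) = Ext N X A" "Comp C (Proj N X A) (ext_pair N X A \<sigma> a) = \<sigma>"
    "act (Tm N) (ext_pair N X A \<sigma> a) (Gen N X A) = a"
  using theI'[OF ext_universal(2)[of X A \<sigma> a]] assms category_simps(2)[of \<sigma>]
  by (simp_all add: ext_pair_def Hom_iff)

text \<open>Uniqueness in the universal property. The typing condition on
  \<open>(\<sigma>, a)\<close> is derived from the presentation of this pair by
  \<open>h\<close>.\<close>

lemma ext_pair_eqI:
  assumes X: "X \<in> Ob C" "A \<in> sec (Ty N) X"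
    and h: "h \<in> Arr C" "Cod C h = Ext N X A"
    and "Comp C (Proj N X A) h = \<sigma>" "act (Tm N) h (Gen N X A) = a"
  shows "ext_pair N X A \<sigma> a = h"
proof -
  have [simp]: "Gen N X A \<in> sec (Tm N) (Cod C h)" "A \<in> sec (Ty N) (Cod C (Proj N X A))"
    using X h by simp_all
  \<comment> \<open>\<open>typeof (q[h]) = (typeof q)[h] = A[p][h] = A[p \<circ> h]\<close>, by
    naturality of typing and functoriality of types.\<close>
  have "Typing N (Dom C h) a = act (Ty N) \<sigma> A"
    using typing_simps(2)[of h "Gen N X A"] presheaf_simps(3)[of h "Proj N X A" A] assms by simp
  moreover have \<sigma>: "\<sigma> \<in> Arr C" "Dom C \<sigma> = Dom C h" "Cod C \<sigma> = X" "a \<in> sec (Tm N) (Dom C h)"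
    using assms by auto
  ultimately have "\<exists>!h. h \<in> Hom C (Dom C \<sigma>) (Ext N X A) \<and> Comp C (Proj N X A) h = \<sigma> \<and>
      act (Tm N) h (Gen N X A) = a"
    by (intro ext_universal(2)[OF X]) simp_all
  then show ?thesis
    unfolding ext_pair_def by (rule the1_equality) (simp add: Hom_iff assms \<sigma>)
qed

text \<open>The form that uniqueness takes in the last equation of the theory.\<close>

lemma ext_pair_Proj_Gen [simp]:
  assumes "X \<in> Ob C" "A \<in> sec (Ty N) X" "h \<in> Arr C" "Cod C h = Ext N X A"
  shows "ext_pair N X A (Comp C (Proj N X A) h) (act (Tm N) h (Gen N X A)) = h"
  using assms by (simp add: ext_pair_eqI)

section \<open>Domains, values and equations of \<open>model_of N\<close>\<close>

lemma dom_nm_oper: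
  "dom (nm_oper N f) = {xs \<in> listset (map (nm_carrier N) (nm_arity f)).
     \<forall>e \<in> set (nm_dom_eqs f). holds (model_of N) (\<lambda>s i. xs ! i) e}"
proof -
  \<comment> \<open>On well-sorted arguments the tests in \<open>nm_oper\<close> amount to the
    domain equations. For \<open>INDSUB\<close> the test \<open>\<Delta> = Dom C \<sigma>\<close> is
    contained in the second equation, which compares types tagged with \<open>\<Delta>\<close> and
    \<open>Dom C \<sigma>\<close>.\<close>
  have "nm_oper N f xs \<noteq> None \<longleftrightarrow> (\<forall>e \<in> set (nm_dom_eqs f). holds (model_of N) (\<lambda>s i. xs ! i) e)"
    if "xs \<in> listset (map (nm_carrier N) (nm_arity f))" for xs
    using that
    by (cases f) (auto simp: in_listset_Cons_iff nm_oper_simps holds_def model_of_def numeral_2_eq_2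
        split: if_splits)
  then show ?thesis
    using nm_oper_eq_None[of _ N f] by (simp add: dom_def set_eq_iff) (metis option.distinct(1))
qed

lemma ran_nm_oper: "ran (nm_oper N f) \<subseteq> nm_carrier N (nm_result f)"
proof
  fix y assume "y \<in> ran (nm_oper N f)"
  then obtain xs where xs: "nm_oper N f xs = Some y"
    by (auto simp: ran_def)
  then have "xs \<in> listset (map (nm_carrier N) (nm_arity f))"
    using nm_oper_eq_None[of xs N f] by force
  with xs show "y \<in> nm_carrier N (nm_result f)"
    by (cases f) (auto simp: in_listset_Cons_iff nm_oper_simps split: if_splits)
qed

text \<open>Once evaluated, the equations follow from the rewrite rules above; splitting the
  definedness of every subterm supplies their premises.\<close>

lemma satisfies_axioms: "\<forall>e \<in> set nm_axioms. satisfies (model_of N) e"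
  unfolding nm_axioms_def Let_def list.set ball_simps
  by (intro conjI; auto simp: satisfies_def model_of_def nm_oper_simps bind_eq_Some_conv
      split: if_splits)

lemma model_of_T_NM: "eat_model T_NM (model_of N)"
  unfolding eat_model_def
  using dom_nm_oper ran_nm_oper satisfies_axioms by (simp add: T_NM_def) (simp add: model_of_def)

text \<open>Both sides are endomorphisms of a terminal object.\<close>

lemma model_of_esub_empty: "satisfies (model_of N) esub_empty"
  by (simp add: satisfies_def esub_empty_def model_of_def nm_oper_simps bang_eqI)

end

section \<open>The natural model given by a model of the theory\<close>

locale nm_theory_model =
  fixes M :: "(nm_sort, nm_symbol, 'u) interp"
  assumes model: "eat_model T_NM M"
begin

text \<open>Kept opaque: with \<open>op_val\<close>, which unfolds to \<open>the (oper M f xs)\<close>, the rules \<open>oper_total\<close>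
  below would loop as rewrite rules.\<close>

definition app :: "nm_symbol \<Rightarrow> 'u list \<Rightarrow> 'u" where
  "app f xs = the (oper M f xs)"

abbreviation "ctx \<equiv> carrier M Ctx"
abbreviation "sub \<equiv> carrier M Sub"
abbreviation "typ \<equiv> carrier M Type"
abbreviation "trm \<equiv> carrier M Term"
abbreviation "dm \<sigma> \<equiv> app DOM [\<sigma>]"
abbreviation "cd \<sigma> \<equiv> app COD [\<sigma>]"
abbreviation "ide \<Gamma> \<equiv> app ID [\<Gamma>]"
abbreviation "emp \<equiv> app EMPTY []"
abbreviation "esub \<Gamma> \<equiv> app ESUB [\<Gamma>]"
abbreviation "typeof a \<equiv> app TYPEOF [a]"
abbreviation "ctxof_ty A \<equiv> app CTXOF_TY [A]"
abbreviation "ctxof_tm a \<equiv> app CTXOF_TM [a]"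
abbreviation "cext A \<equiv> app CEXT [A]"
abbreviation "prj A \<equiv> app PROJ [A]"
abbreviation "gen A \<equiv> app VAR [A]"
abbreviation "cmp \<sigma> \<tau> \<equiv> app COMP [\<sigma>, \<tau>]"
abbreviation "subst_ty \<sigma> A \<equiv> app SUBST_TY [\<sigma>, A]"
abbreviation "subst_tm \<sigma> a \<equiv> app SUBST_TM [\<sigma>, a]"
abbreviation "ind \<sigma> a A \<equiv> app INDSUB [\<sigma>, a, A]"

lemma nat_model_of_sel:
  "Ob (Base (nat_model_of M)) = ctx" "Arr (Base (nat_model_of M)) = sub"
  "Dom (Base (nat_model_of M)) \<sigma> = dm \<sigma>" "Cod (Base (nat_model_of M)) \<sigma> = cd \<sigma>"
  "Ident (Base (nat_model_of M)) \<Gamma> = ide \<Gamma>" "Comp (Base (nat_model_of M)) \<tau> \<sigma> = cmp \<sigma> \<tau>"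
  "Emp (nat_model_of M) = emp"
  "sec (Ty (nat_model_of M)) \<Gamma> = {A \<in> typ. ctxof_ty A = \<Gamma>}"
  "act (Ty (nat_model_of M)) \<sigma> A = subst_ty \<sigma> A"
  "sec (Tm (nat_model_of M)) \<Gamma> = {a \<in> trm. ctxof_tm a = \<Gamma>}"
  "act (Tm (nat_model_of M)) \<sigma> a = subst_tm \<sigma> a"
  "Typing (nat_model_of M) \<Gamma> a = typeof a"
  "Ext (nat_model_of M) \<Gamma> A = cext A" "Proj (nat_model_of M) \<Gamma> A = prj A"
  "Gen (nat_model_of M) \<Gamma> A = gen A"
  by (simp_all add: nat_model_of_def app_def)

text \<open>Separates definedness from value: the domain equations decide the former, and
  \<open>app\<close> is a total function giving the latter.\<close>

lemma oper_eq:
  assumes "xs \<in> listset (map (carrier M) (nm_arity f))"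
  shows "oper M f xs = (if \<forall>e \<in> set (nm_dom_eqs f). holds M (\<lambda>s i. xs ! i) e
    then Some (app f xs) else None)"
proof -
  have "xs \<in> dom (oper M f) \<longleftrightarrow> (\<forall>e \<in> set (nm_dom_eqs f). holds M (\<lambda>s i. xs ! i) e)"
    using model assms by (simp add: eat_model_def T_NM_def)
  then show ?thesis
    by (auto simp: app_def)
qed

lemma app_closed: "oper M f xs = Some (app f xs) \<Longrightarrow> app f xs \<in> carrier M (nm_result f)"
  using eat_model_closed[OF model] by (simp add: T_NM_def)

lemma oper_total [simp]:
  "\<sigma> \<in> sub \<Longrightarrow> oper M DOM [\<sigma>] = Some (dm \<sigma>)"
  "\<sigma> \<in> sub \<Longrightarrow> oper M COD [\<sigma>] = Some (cd \<sigma>)"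
  "\<Gamma> \<in> ctx \<Longrightarrow> oper M ID [\<Gamma>] = Some (ide \<Gamma>)"
  "oper M EMPTY [] = Some emp"
  "\<Gamma> \<in> ctx \<Longrightarrow> oper M ESUB [\<Gamma>] = Some (esub \<Gamma>)"
  "a \<in> trm \<Longrightarrow> oper M TYPEOF [a] = Some (typeof a)"
  "A \<in> typ \<Longrightarrow> oper M CTXOF_TY [A] = Some (ctxof_ty A)"
  "a \<in> trm \<Longrightarrow> oper M CTXOF_TM [a] = Some (ctxof_tm a)"
  "A \<in> typ \<Longrightarrow> oper M CEXT [A] = Some (cext A)"
  "A \<in> typ \<Longrightarrow> oper M PROJ [A] = Some (prj A)"
  "A \<in> typ \<Longrightarrow> oper M VAR [A] = Some (gen A)"
  by (subst oper_eq; simp)+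

lemma oper_partial [simp]:
  "\<sigma> \<in> sub \<Longrightarrow> \<tau> \<in> sub \<Longrightarrow>
    oper M COMP [\<sigma>, \<tau>] = (if cd \<sigma> = dm \<tau> then Some (cmp \<sigma> \<tau>) else None)"
  "\<sigma> \<in> sub \<Longrightarrow> A \<in> typ \<Longrightarrow>
    oper M SUBST_TY [\<sigma>, A] = (if ctxof_ty A = cd \<sigma> then Some (subst_ty \<sigma> A) else None)"
  "\<sigma> \<in> sub \<Longrightarrow> a \<in> trm \<Longrightarrow>
    oper M SUBST_TM [\<sigma>, a] = (if ctxof_tm a = cd \<sigma> then Some (subst_tm \<sigma> a) else None)"
  by (subst oper_eq; simp add: holds_def)+

text \<open>The domain condition itself contains the partial term \<open>A[\<sigma>]\<close>; by
  \<open>oper_partial\<close> this term is defined exactly when the first equation of the condition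
  holds.\<close>

lemma oper_indsub [simp]:
  "\<sigma> \<in> sub \<Longrightarrow> a \<in> trm \<Longrightarrow> A \<in> typ \<Longrightarrow> oper M INDSUB [\<sigma>, a, A] =
    (if cd \<sigma> = ctxof_ty A \<and> typeof a = subst_ty \<sigma> A then Some (ind \<sigma> a A) else None)"
  by (subst oper_eq; simp add: holds_def numeral_2_eq_2)

lemma closed [simp]:
  "\<sigma> \<in> sub \<Longrightarrow> dm \<sigma> \<in> ctx"
  "\<sigma> \<in> sub \<Longrightarrow> cd \<sigma> \<in> ctx"
  "\<Gamma> \<in> ctx \<Longrightarrow> ide \<Gamma> \<in> sub"
  "emp \<in> ctx"
  "\<Gamma> \<in> ctx \<Longrightarrow> esub \<Gamma> \<in> sub"
  "a \<in> trm \<Longrightarrow> typeof a \<in> typ"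
  "A \<in> typ \<Longrightarrow> ctxof_ty A \<in> ctx"
  "a \<in> trm \<Longrightarrow> ctxof_tm a \<in> ctx"
  "A \<in> typ \<Longrightarrow> cext A \<in> ctx"
  "A \<in> typ \<Longrightarrow> prj A \<in> sub"
  "A \<in> typ \<Longrightarrow> gen A \<in> trm"
  "\<sigma> \<in> sub \<Longrightarrow> \<tau> \<in> sub \<Longrightarrow> cd \<sigma> = dm \<tau> \<Longrightarrow> cmp \<sigma> \<tau> \<in> sub"
  "\<sigma> \<in> sub \<Longrightarrow> A \<in> typ \<Longrightarrow> ctxof_ty A = cd \<sigma> \<Longrightarrow> subst_ty \<sigma> A \<in> typ"
  "\<sigma> \<in> sub \<Longrightarrow> a \<in> trm \<Longrightarrow> ctxof_tm a = cd \<sigma> \<Longrightarrow> subst_tm \<sigma> a \<in> trm"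
  "\<sigma> \<in> sub \<Longrightarrow> a \<in> trm \<Longrightarrow> A \<in> typ \<Longrightarrow> cd \<sigma> = ctxof_ty A \<Longrightarrow> typeof a = subst_ty \<sigma> A \<Longrightarrow>
    ind \<sigma> a A \<in> sub"
  using app_closed[of DOM "[\<sigma>]"] app_closed[of COD "[\<sigma>]"] app_closed[of ID "[\<Gamma>]"]
    app_closed[of EMPTY "[]"] app_closed[of ESUB "[\<Gamma>]"] app_closed[of TYPEOF "[a]"]
    app_closed[of CTXOF_TY "[A]"] app_closed[of CTXOF_TM "[a]"] app_closed[of CEXT "[A]"]
    app_closed[of PROJ "[A]"] app_closed[of VAR "[A]"] app_closed[of COMP "[\<sigma>, \<tau>]"]
    app_closed[of SUBST_TY "[\<sigma>, A]"] app_closed[of SUBST_TM "[\<sigma>, a]"]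
    app_closed[of INDSUB "[\<sigma>, a, A]"]
  by simp_all

text \<open>Extracts an equation by its position in \<open>nm_axioms\<close>. The valuations used
  below are a \<open>case\<close> on the sort, left unspecified at sorts that do not occur in the
  equation.\<close>

lemma axiom_nth:
  assumes "k < 27" "\<forall>(s, i) \<in> vars (fst (nm_axioms ! k)) \<union> vars (snd (nm_axioms ! k)). v s i \<in> carrier M s"
    "eval M v (fst (nm_axioms ! k)) = Some x" "eval M v (snd (nm_axioms ! k)) = Some y"
  shows "x = y"
proof -
  have "nm_axioms ! k \<in> set nm_axioms"
    using assms(1) by (intro nth_mem) (simp add: nm_axioms_def Let_def)
  then have "satisfies M (nm_axioms ! k)"
    using model by (simp add: eat_model_def T_NM_def)
  with assms(2-) show ?thesis
    unfolding satisfies_def by blast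
qed

section \<open>The equations of the theory as rewrite rules\<close>

lemma dom_cod_simps [simp]:
  "\<Gamma> \<in> ctx \<Longrightarrow> dm (ide \<Gamma>) = \<Gamma>"
  "\<Gamma> \<in> ctx \<Longrightarrow> cd (ide \<Gamma>) = \<Gamma>"
  "\<sigma> \<in> sub \<Longrightarrow> \<tau> \<in> sub \<Longrightarrow> cd \<sigma> = dm \<tau> \<Longrightarrow> dm (cmp \<sigma> \<tau>) = dm \<sigma>"
  "\<sigma> \<in> sub \<Longrightarrow> \<tau> \<in> sub \<Longrightarrow> cd \<sigma> = dm \<tau> \<Longrightarrow> cd (cmp \<sigma> \<tau>) = cd \<tau>"
  subgoal by (rule axiom_nth[of 0 "\<lambda>s i. case s of Ctx \<Rightarrow> \<Gamma>"])
    (auto simp: nm_axioms_def Let_def)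
  subgoal by (rule axiom_nth[of 1 "\<lambda>s i. case s of Ctx \<Rightarrow> \<Gamma>"])
    (auto simp: nm_axioms_def Let_def)
  subgoal by (rule axiom_nth[of 2 "\<lambda>s i. case s of Sub \<Rightarrow> [\<sigma>, \<tau>] ! i"])
    (auto simp: nm_axioms_def Let_def)
  subgoal by (rule axiom_nth[of 3 "\<lambda>s i. case s of Sub \<Rightarrow> [\<sigma>, \<tau>] ! i"])
    (auto simp: nm_axioms_def Let_def)
  done

text \<open>Since \<open>cmp\<close> composes in diagrammatic order, this orientation of
  associativity agrees with that of \<open>category_simps\<close> for \<open>Comp\<close>.\<close>

lemma comp_simps [simp]:
  "\<sigma> \<in> sub \<Longrightarrow> dm \<sigma> = \<Gamma> \<Longrightarrow> cmp (ide \<Gamma>) \<sigma> = \<sigma>"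
  "\<tau> \<in> sub \<Longrightarrow> cd \<tau> = \<Gamma> \<Longrightarrow> cmp \<tau> (ide \<Gamma>) = \<tau>"
  "\<sigma> \<in> sub \<Longrightarrow> \<tau> \<in> sub \<Longrightarrow> \<upsilon> \<in> sub \<Longrightarrow> cd \<sigma> = dm \<tau> \<Longrightarrow> cd \<tau> = dm \<upsilon> \<Longrightarrow>
    cmp \<sigma> (cmp \<tau> \<upsilon>) = cmp (cmp \<sigma> \<tau>) \<upsilon>"
  subgoal by (rule axiom_nth[of 4 "\<lambda>s i. case s of Ctx \<Rightarrow> \<Gamma> | Sub \<Rightarrow> [\<sigma>] ! i"])
    (auto simp: nm_axioms_def Let_def)
  \<comment> \<open>The variable of this equation is \<open>Var Sub 1\<close>, so the list must
    reach position 1.\<close>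
  subgoal by (rule axiom_nth[of 5 "\<lambda>s i. case s of Ctx \<Rightarrow> \<Gamma> | Sub \<Rightarrow> [\<tau>, \<tau>] ! i"])
    (auto simp: nm_axioms_def Let_def)
  subgoal by (rule axiom_nth[of 6 "\<lambda>s i. case s of Sub \<Rightarrow> [\<sigma>, \<tau>, \<upsilon>] ! i"])
    (auto simp: nm_axioms_def Let_def)
  done

lemma esub_dom_cod [simp]:
  "\<Gamma> \<in> ctx \<Longrightarrow> dm (esub \<Gamma>) = \<Gamma>"
  "\<Gamma> \<in> ctx \<Longrightarrow> cd (esub \<Gamma>) = emp"
  subgoal by (rule axiom_nth[of 7 "\<lambda>s i. case s of Ctx \<Rightarrow> \<Gamma>"])
    (auto simp: nm_axioms_def Let_def)
  subgoal by (rule axiom_nth[of 8 "\<lambda>s i. case s of Ctx \<Rightarrow> \<Gamma>"])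
    (auto simp: nm_axioms_def Let_def)
  done

lemma comp_esub [simp]:
  "\<sigma> \<in> sub \<Longrightarrow> cd \<sigma> = \<Gamma> \<Longrightarrow> cmp \<sigma> (esub \<Gamma>) = esub (dm \<sigma>)"
  by (rule axiom_nth[of 9 "\<lambda>s i. case s of Sub \<Rightarrow> [\<sigma>] ! i"])
    (auto simp: nm_axioms_def Let_def)

text \<open>Comes before the functor laws because \<open>A[\<tau>][\<sigma>]\<close> is defined only
  once the context of \<open>A[\<tau>]\<close> is known to be the domain of
  \<open>\<tau>\<close>.\<close>

lemma ctxof_subst [simp]:
  "\<sigma> \<in> sub \<Longrightarrow> A \<in> typ \<Longrightarrow> ctxof_ty A = cd \<sigma> \<Longrightarrow> ctxof_ty (subst_ty \<sigma> A) = dm \<sigma>"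
  "\<sigma> \<in> sub \<Longrightarrow> a \<in> trm \<Longrightarrow> ctxof_tm a = cd \<sigma> \<Longrightarrow> ctxof_tm (subst_tm \<sigma> a) = dm \<sigma>"
  subgoal by (rule axiom_nth[of 12 "\<lambda>s i. case s of Sub \<Rightarrow> [\<sigma>] ! i | Type \<Rightarrow> A"])
    (auto simp: nm_axioms_def Let_def)
  subgoal by (rule axiom_nth[of 15 "\<lambda>s i. case s of Sub \<Rightarrow> [\<sigma>] ! i | Term \<Rightarrow> a"])
    (auto simp: nm_axioms_def Let_def)
  done

lemma subst_id_comp [simp]:
  "A \<in> typ \<Longrightarrow> ctxof_ty A = \<Gamma> \<Longrightarrow> subst_ty (ide \<Gamma>) A = A"
  "\<sigma> \<in> sub \<Longrightarrow> \<tau> \<in> sub \<Longrightarrow> A \<in> typ \<Longrightarrow> cd \<sigma> = dm \<tau> \<Longrightarrow> ctxof_ty A = cd \<tau> \<Longrightarrow>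
    subst_ty (cmp \<sigma> \<tau>) A = subst_ty \<sigma> (subst_ty \<tau> A)"
  "a \<in> trm \<Longrightarrow> ctxof_tm a = \<Gamma> \<Longrightarrow> subst_tm (ide \<Gamma>) a = a"
  "\<sigma> \<in> sub \<Longrightarrow> \<tau> \<in> sub \<Longrightarrow> a \<in> trm \<Longrightarrow> cd \<sigma> = dm \<tau> \<Longrightarrow> ctxof_tm a = cd \<tau> \<Longrightarrow>
    subst_tm (cmp \<sigma> \<tau>) a = subst_tm \<sigma> (subst_tm \<tau> a)"
  subgoal by (rule axiom_nth[of 10 "\<lambda>s i. case s of Ctx \<Rightarrow> \<Gamma> | Type \<Rightarrow> A"])
    (auto simp: nm_axioms_def Let_def)
  subgoal by (rule axiom_nth[of 11 "\<lambda>s i. case s of Sub \<Rightarrow> [\<sigma>, \<tau>] ! i | Type \<Rightarrow> A"])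
    (auto simp: nm_axioms_def Let_def)
  subgoal by (rule axiom_nth[of 13 "\<lambda>s i. case s of Ctx \<Rightarrow> \<Gamma> | Term \<Rightarrow> a"])
    (auto simp: nm_axioms_def Let_def)
  subgoal by (rule axiom_nth[of 14 "\<lambda>s i. case s of Sub \<Rightarrow> [\<sigma>, \<tau>] ! i | Term \<Rightarrow> a"])
    (auto simp: nm_axioms_def Let_def)
  done

lemma ctxof_typeof [simp]:
  "a \<in> trm \<Longrightarrow> ctxof_ty (typeof a) = ctxof_tm a"
  by (rule axiom_nth[of 16 "\<lambda>s i. case s of Term \<Rightarrow> a"])
    (auto simp: nm_axioms_def Let_def)

lemma typeof_subst [simp]:
  "\<sigma> \<in> sub \<Longrightarrow> a \<in> trm \<Longrightarrow> ctxof_tm a = cd \<sigma> \<Longrightarrow>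
    typeof (subst_tm \<sigma> a) = subst_ty \<sigma> (typeof a)"
  by (rule axiom_nth[of 17 "\<lambda>s i. case s of Sub \<Rightarrow> [\<sigma>] ! i | Term \<Rightarrow> a"])
    (auto simp: nm_axioms_def Let_def)

lemma ext_dom_cod [simp]:
  "A \<in> typ \<Longrightarrow> dm (prj A) = cext A"
  "A \<in> typ \<Longrightarrow> cd (prj A) = ctxof_ty A"
  "A \<in> typ \<Longrightarrow> ctxof_tm (gen A) = cext A"
  subgoal by (rule axiom_nth[of 18 "\<lambda>s i. case s of Type \<Rightarrow> A"])
    (auto simp: nm_axioms_def Let_def)
  subgoal by (rule axiom_nth[of 19 "\<lambda>s i. case s of Type \<Rightarrow> A"])
    (auto simp: nm_axioms_def Let_def)
  subgoal by (rule axiom_nth[of 20 "\<lambda>s i. case s of Type \<Rightarrow> A"])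
    (auto simp: nm_axioms_def Let_def)
  done

lemma typeof_gen [simp]:
  "A \<in> typ \<Longrightarrow> typeof (gen A) = subst_ty (prj A) A"
  by (rule axiom_nth[of 21 "\<lambda>s i. case s of Type \<Rightarrow> A"])
    (auto simp: nm_axioms_def Let_def)

lemma ind_dom_cod [simp]:
  "\<sigma> \<in> sub \<Longrightarrow> a \<in> trm \<Longrightarrow> A \<in> typ \<Longrightarrow> cd \<sigma> = ctxof_ty A \<Longrightarrow> typeof a = subst_ty \<sigma> A \<Longrightarrow>
    dm (ind \<sigma> a A) = dm \<sigma>"
  "\<sigma> \<in> sub \<Longrightarrow> a \<in> trm \<Longrightarrow> A \<in> typ \<Longrightarrow> cd \<sigma> = ctxof_ty A \<Longrightarrow> typeof a = subst_ty \<sigma> A \<Longrightarrow>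
    cd (ind \<sigma> a A) = cext A"
  subgoal by (rule axiom_nth[of 22 "\<lambda>s i. case s of Sub \<Rightarrow> [\<sigma>] ! i | Type \<Rightarrow> A | Term \<Rightarrow> a"])
    (auto simp: nm_axioms_def Let_def)
  subgoal by (rule axiom_nth[of 23 "\<lambda>s i. case s of Sub \<Rightarrow> [\<sigma>] ! i | Type \<Rightarrow> A | Term \<Rightarrow> a"])
    (auto simp: nm_axioms_def Let_def)
  done

lemma ind_universal [simp]:
  "\<sigma> \<in> sub \<Longrightarrow> a \<in> trm \<Longrightarrow> A \<in> typ \<Longrightarrow> cd \<sigma> = ctxof_ty A \<Longrightarrow> typeof a = subst_ty \<sigma> A \<Longrightarrow>
    cmp (ind \<sigma> a A) (prj A) = \<sigma>"
  "\<sigma> \<in> sub \<Longrightarrow> a \<in> trm \<Longrightarrow> A \<in> typ \<Longrightarrow> cd \<sigma> = ctxof_ty A \<Longrightarrow> typeof a = subst_ty \<sigma> A \<Longrightarrow>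
    subst_tm (ind \<sigma> a A) (gen A) = a"
  "\<sigma> \<in> sub \<Longrightarrow> A \<in> typ \<Longrightarrow> cd \<sigma> = cext A \<Longrightarrow>
    ind (cmp \<sigma> (prj A)) (subst_tm \<sigma> (gen A)) A = \<sigma>"
  subgoal by (rule axiom_nth[of 24 "\<lambda>s i. case s of Sub \<Rightarrow> [\<sigma>] ! i | Type \<Rightarrow> A | Term \<Rightarrow> a"])
    (auto simp: nm_axioms_def Let_def)
  subgoal by (rule axiom_nth[of 25 "\<lambda>s i. case s of Sub \<Rightarrow> [\<sigma>] ! i | Type \<Rightarrow> A | Term \<Rightarrow> a"])
    (auto simp: nm_axioms_def Let_def)
  subgoal by (rule axiom_nth[of 26 "\<lambda>s i. case s of Sub \<Rightarrow> [\<sigma>] ! i | Type \<Rightarrow> A"])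
    (auto simp: nm_axioms_def Let_def)
  done

section \<open>The clauses of a natural model for \<open>nat_model_of M\<close>\<close>

lemma satisfies_esub_empty_iff: "satisfies M esub_empty \<longleftrightarrow> esub emp = ide emp"
  by (simp add: satisfies_def esub_empty_def)

lemma small_category_nat_model_of: "small_category (Base (nat_model_of M))"
  by (simp add: small_category_def nat_model_of_sel Hom_iff)

text \<open>The arrows \<open>esub \<Gamma>\<close> always exist, so terminality is a matter of
  uniqueness; the two arrows \<open>esub emp\<close> and \<open>ide emp\<close> from
  \<open>emp\<close> to itself are the decisive case.\<close>

lemma terminal_nat_model_of_iff:
  "terminal (Base (nat_model_of M)) emp \<longleftrightarrow> esub emp = ide emp"
proof
  assume "terminal (Base (nat_model_of M)) emp"
  then have "\<exists>!f. f \<in> Hom (Base (nat_model_of M)) emp emp"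
    by (simp add: terminal_def nat_model_of_sel)
  moreover have "esub emp \<in> Hom (Base (nat_model_of M)) emp emp"
    "ide emp \<in> Hom (Base (nat_model_of M)) emp emp"
    by (simp_all add: Hom_iff nat_model_of_sel)
  ultimately show "esub emp = ide emp"
    by blast
next
  assume *: "esub emp = ide emp"
  have "\<exists>!f. f \<in> Hom (Base (nat_model_of M)) \<Gamma> emp" if "\<Gamma> \<in> ctx" for \<Gamma>
  proof (rule ex1I[of _ "esub \<Gamma>"])
    show "esub \<Gamma> \<in> Hom (Base (nat_model_of M)) \<Gamma> emp"
      using that by (simp add: Hom_iff nat_model_of_sel)
    \<comment> \<open>\<open>f = cmp f (ide emp) = cmp f (esub emp) = esub (dm f)\<close>, by the
      identity law, the extra equation and naturality of \<open>esub\<close>.\<close>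
    show "f = esub \<Gamma>" if "f \<in> Hom (Base (nat_model_of M)) \<Gamma> emp" for f
      using that comp_esub[of f emp] * by (simp add: Hom_iff nat_model_of_sel)
  qed
  then show "terminal (Base (nat_model_of M)) emp"
    by (simp add: terminal_def nat_model_of_sel)
qed

lemma presheaf_nat_model_of:
  "presheaf (Base (nat_model_of M)) (Ty (nat_model_of M))"
  "presheaf (Base (nat_model_of M)) (Tm (nat_model_of M))"
  by (simp_all add: presheaf_def nat_model_of_sel)

lemma nat_trans_nat_model_of:
  "nat_trans (Base (nat_model_of M)) (Tm (nat_model_of M)) (Ty (nat_model_of M))
     (Typing (nat_model_of M))"
  by (simp add: nat_trans_def nat_model_of_sel)

text \<open>Existence is given by the projection equations for \<open>ind\<close>. For uniqueness,
  the last axiom rewrites any solution \<open>h\<close> as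
  \<open>ind (cmp h (prj A)) (subst_tm h (gen A)) A\<close>, that is, as
  \<open>ind \<sigma> a A\<close>.\<close>

lemma ex1_ind:
  assumes "\<sigma> \<in> sub" "a \<in> trm" "A \<in> typ" "cd \<sigma> = ctxof_ty A" "typeof a = subst_ty \<sigma> A"
  shows "\<exists>!h. h \<in> Hom (Base (nat_model_of M)) (dm \<sigma>) (cext A) \<and> cmp h (prj A) = \<sigma> \<and>
    subst_tm h (gen A) = a"
proof (rule ex1I[of _ "ind \<sigma> a A"])
  show "ind \<sigma> a A \<in> Hom (Base (nat_model_of M)) (dm \<sigma>) (cext A) \<and> cmp (ind \<sigma> a A) (prj A) = \<sigma> \<and>
    subst_tm (ind \<sigma> a A) (gen A) = a"
    using assms by (simp add: Hom_iff nat_model_of_sel)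
qed (use assms in \<open>auto simp: Hom_iff nat_model_of_sel\<close>)

lemma pullback_square_nat_model_of:
  assumes "A \<in> typ" "ctxof_ty A = \<Gamma>"
  shows "pullback_square (Base (nat_model_of M))
    (yo (Base (nat_model_of M)) (cext A)) (Tm (nat_model_of M))
    (yo (Base (nat_model_of M)) \<Gamma>) (Ty (nat_model_of M))
    (elem_map (Tm (nat_model_of M)) (gen A)) (yo_map (Base (nat_model_of M)) (prj A))
    (Typing (nat_model_of M)) (elem_map (Ty (nat_model_of M)) A)"
proof (subst pullback_square_representable_iff)
  show "Typing (nat_model_of M) (cext A) (gen A) = act (Ty (nat_model_of M)) (prj A) A \<and>
    (\<forall>W \<in> Ob (Base (nat_model_of M)). \<forall>\<sigma> \<in> Hom (Base (nat_model_of M)) W \<Gamma>.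
      \<forall>a \<in> sec (Tm (nat_model_of M)) W.
        Typing (nat_model_of M) W a = act (Ty (nat_model_of M)) \<sigma> A \<longrightarrow>
        (\<exists>!h. h \<in> Hom (Base (nat_model_of M)) W (cext A) \<and>
          Comp (Base (nat_model_of M)) (prj A) h = \<sigma> \<and> act (Tm (nat_model_of M)) h (gen A) = a))"
  proof (intro conjI ballI impI)
    fix W \<sigma> a
    assume "\<sigma> \<in> Hom (Base (nat_model_of M)) W \<Gamma>" "a \<in> sec (Tm (nat_model_of M)) W"
      "Typing (nat_model_of M) W a = act (Ty (nat_model_of M)) \<sigma> A"
    with assms show "\<exists>!h. h \<in> Hom (Base (nat_model_of M)) W (cext A) \<and>
        Comp (Base (nat_model_of M)) (prj A) h = \<sigma> \<and> act (Tm (nat_model_of M)) h (gen A) = a"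
      using ex1_ind[of \<sigma> a A] by (simp add: nat_model_of_sel Hom_iff)
  qed (use assms in \<open>simp add: nat_model_of_sel\<close>)
qed (use assms in \<open>auto simp: small_category_nat_model_of presheaf_nat_model_of
  nat_trans_nat_model_of nat_model_of_sel Hom_iff\<close>)

text \<open>All clauses of \<open>natural_model\<close> other than terminality hold for every model
  of the theory, so the equivalence reduces to \<open>terminal_nat_model_of_iff\<close>.\<close>

lemma natural_model_nat_model_of_iff:
  "natural_model (nat_model_of M) \<longleftrightarrow> satisfies M esub_empty"
  using small_category_nat_model_of terminal_nat_model_of_iff presheaf_nat_model_of
    nat_trans_nat_model_of pullback_square_nat_model_of
  by (auto simp: natural_model_def satisfies_esub_empty_iff nat_model_of_sel Hom_iff)

end

section \<open>Recovering a model of the theory from its natural model\<close>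

fun untag :: "'u nm_elem \<Rightarrow> 'u" where
  "untag (CtxE \<Gamma>) = \<Gamma>"
| "untag (SubE \<sigma>) = \<sigma>"
| "untag (TypeE \<Gamma> A) = A"
| "untag (TermE \<Gamma> a) = a"

text \<open>Forgetting tags loses nothing here: in \<open>nat_model_of M\<close> a type or term lies
  over its own \<open>ctxof\<close> only, so its tag can be recomputed.\<close>

lemma model_iso_model_of_nat_model_of:
  assumes "eat_model T_NM M" "satisfies M esub_empty"
  shows "model_iso T_NM (model_of (nat_model_of M)) M"
proof -
  interpret nm_theory_model M
    using assms by unfold_locales
  interpret N: natural_model_structure "nat_model_of M"
    using assms by unfold_locales (simp add: natural_model_nat_model_of_iff)
  have bang: "bang (nat_model_of M) \<Gamma> = esub \<Gamma>" if "\<Gamma> \<in> ctx" for \<Gamma>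
    using that by (intro N.bang_eqI) (simp_all add: nat_model_of_sel)
  have pair: "ext_pair (nat_model_of M) \<Gamma> A \<sigma> a = ind \<sigma> a A"
    if "\<sigma> \<in> sub" "a \<in> trm" "A \<in> typ" "ctxof_ty A = \<Gamma>" "cd \<sigma> = \<Gamma>" "typeof a = subst_ty \<sigma> A"
    for \<Gamma> A \<sigma> a
    using that by (intro N.ext_pair_eqI) (auto simp: nat_model_of_sel)
  \<comment> \<open>The clause for \<open>INDSUB\<close> in \<open>nm_oper\<close> tests that
    \<open>a\<close> lives over the domain of \<open>\<sigma>\<close>; in the theory this follows
    from the type of \<open>a\<close>.\<close>
  have ctxof: "ctxof_tm a = dm \<sigma>"
    if "typeof a = subst_ty \<sigma> A" "\<sigma> \<in> sub" "a \<in> trm" "A \<in> typ" "cd \<sigma> = ctxof_ty A" for A \<sigma> a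
    using that ctxof_typeof[of a] by simp
  define tag where "tag s x = (case s of Ctx \<Rightarrow> CtxE x | Sub \<Rightarrow> SubE x
    | Type \<Rightarrow> TypeE (ctxof_ty x) x | Term \<Rightarrow> TermE (ctxof_tm x) x)" for s x
  have "bij_betw untag (nm_carrier (nat_model_of M) s) (carrier M s)" for s
    by (rule bij_betw_byWitness[where f' = "tag s"]; cases s)
      (auto simp: tag_def nat_model_of_sel)
  moreover have "oper M f (map2 (\<lambda>_. untag) (nm_arity f) xs) =
      map_option untag (nm_oper (nat_model_of M) f xs)"
    if "xs \<in> listset (map (nm_carrier (nat_model_of M)) (nm_arity f))" for f xs
    using that
    by (cases f) (auto simp: in_listset_Cons_iff nm_oper_simps nat_model_of_sel bang pair
        dest: ctxof)
  ultimately show ?thesis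
    unfolding model_iso_def
    by (intro exI[of _ "\<lambda>_. untag"]) (simp add: model_of_def T_NM_def)
qed

section \<open>Isomorphisms\<close>

fun transport :: "('u \<Rightarrow> 'v) \<Rightarrow> ('u \<Rightarrow> 'v) \<Rightarrow> ('u \<Rightarrow> 'u \<Rightarrow> 'v) \<Rightarrow> ('u \<Rightarrow> 'u \<Rightarrow> 'v) \<Rightarrow>
    'u nm_elem \<Rightarrow> 'v nm_elem" where
  "transport F G \<phi> \<psi> (CtxE \<Gamma>) = CtxE (F \<Gamma>)"
| "transport F G \<phi> \<psi> (SubE \<sigma>) = SubE (G \<sigma>)"
| "transport F G \<phi> \<psi> (TypeE \<Gamma> A) = TypeE (F \<Gamma>) (\<phi> \<Gamma> A)"
| "transport F G \<phi> \<psi> (TermE \<Gamma> a) = TermE (F \<Gamma>) (\<psi> \<Gamma> a)"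

text \<open>Partial operations must be defined on corresponding arguments, so the side conditions
  have to be reflected as well as preserved; the bijections provide this by injectivity.\<close>

lemma model_iso_if_nat_model_iso:
  assumes "natural_model N" "natural_model N'" and iso: "nat_model_iso N N'"
  shows "model_iso T_NM (model_of N) (model_of N')"
proof -
  interpret N: natural_model_structure N by unfold_locales fact
  interpret N': natural_model_structure N' by unfold_locales fact
  obtain F G \<phi> \<psi> where
    F: "bij_betw F (Ob N.C) (Ob N'.C)" and G: "bij_betw G (Arr N.C) (Arr N'.C)"
    and DomCod: "\<forall>f \<in> Arr N.C. Dom N'.C (G f) = F (Dom N.C f) \<and> Cod N'.C (G f) = F (Cod N.C f)"
    and Ident: "\<forall>\<Gamma> \<in> Ob N.C. G (Ident N.C \<Gamma>) = Ident N'.C (F \<Gamma>)"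
    and Comp: "\<forall>f \<in> Arr N.C. \<forall>g \<in> Arr N.C. Cod N.C f = Dom N.C g \<longrightarrow>
      G (Comp N.C g f) = Comp N'.C (G g) (G f)"
    and Emp: "F (Emp N) = Emp N'"
    and \<phi>: "\<forall>\<Gamma> \<in> Ob N.C. bij_betw (\<phi> \<Gamma>) (sec (Ty N) \<Gamma>) (sec (Ty N') (F \<Gamma>))"
    and \<psi>: "\<forall>\<Gamma> \<in> Ob N.C. bij_betw (\<psi> \<Gamma>) (sec (Tm N) \<Gamma>) (sec (Tm N') (F \<Gamma>))"
    and act_Ty: "\<forall>f \<in> Arr N.C. \<forall>A \<in> sec (Ty N) (Cod N.C f).
      \<phi> (Dom N.C f) (act (Ty N) f A) = act (Ty N') (G f) (\<phi> (Cod N.C f) A)"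
    and act_Tm: "\<forall>f \<in> Arr N.C. \<forall>a \<in> sec (Tm N) (Cod N.C f).
      \<psi> (Dom N.C f) (act (Tm N) f a) = act (Tm N') (G f) (\<psi> (Cod N.C f) a)"
    and Typing: "\<forall>\<Gamma> \<in> Ob N.C. \<forall>a \<in> sec (Tm N) \<Gamma>.
      \<phi> \<Gamma> (Typing N \<Gamma> a) = Typing N' (F \<Gamma>) (\<psi> \<Gamma> a)"
    and Ext: "\<forall>\<Gamma> \<in> Ob N.C. \<forall>A \<in> sec (Ty N) \<Gamma>.
      F (Ext N \<Gamma> A) = Ext N' (F \<Gamma>) (\<phi> \<Gamma> A) \<and> G (Proj N \<Gamma> A) = Proj N' (F \<Gamma>) (\<phi> \<Gamma> A) \<and>
      \<psi> (Ext N \<Gamma> A) (Gen N \<Gamma> A) = Gen N' (F \<Gamma>) (\<phi> \<Gamma> A)"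
    using iso unfolding nat_model_iso_def Let_def by (elim exE conjE)
  have F_in [simp]: "F \<Gamma> \<in> Ob N'.C" if "\<Gamma> \<in> Ob N.C" for \<Gamma>
    using F that by (rule bij_betwE[rule_format])
  have G_in [simp]: "G \<sigma> \<in> Arr N'.C" if "\<sigma> \<in> Arr N.C" for \<sigma>
    using G that by (rule bij_betwE[rule_format])
  have \<phi>_in [simp]: "\<phi> \<Gamma> A \<in> sec (Ty N') (F \<Gamma>)" if "\<Gamma> \<in> Ob N.C" "A \<in> sec (Ty N) \<Gamma>" for \<Gamma> A
    using \<phi>[rule_format, OF that(1)] that(2) by (rule bij_betwE[rule_format])
  have \<psi>_in [simp]: "\<psi> \<Gamma> a \<in> sec (Tm N') (F \<Gamma>)" if "\<Gamma> \<in> Ob N.C" "a \<in> sec (Tm N) \<Gamma>" for \<Gamma> a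
    using \<psi>[rule_format, OF that(1)] that(2) by (rule bij_betwE[rule_format])
  have F_eq [simp]: "F \<Gamma> = F \<Delta> \<longleftrightarrow> \<Gamma> = \<Delta>" if "\<Gamma> \<in> Ob N.C" "\<Delta> \<in> Ob N.C" for \<Gamma> \<Delta>
    using F that by (auto simp: bij_betw_def inj_on_def)
  have G_eq: "G \<sigma> = G \<tau> \<longleftrightarrow> \<sigma> = \<tau>" if "\<sigma> \<in> Arr N.C" "\<tau> \<in> Arr N.C" for \<sigma> \<tau>
    using G that by (auto simp: bij_betw_def inj_on_def)
  have \<phi>_eq: "\<phi> \<Gamma> A = \<phi> \<Gamma> B \<longleftrightarrow> A = B"
    if "\<Gamma> \<in> Ob N.C" "A \<in> sec (Ty N) \<Gamma>" "B \<in> sec (Ty N) \<Gamma>" for \<Gamma> A B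
    using \<phi> that by (auto simp: bij_betw_def inj_on_def)
  have \<psi>_eq: "\<psi> \<Gamma> a = \<psi> \<Gamma> b \<longleftrightarrow> a = b"
    if "\<Gamma> \<in> Ob N.C" "a \<in> sec (Tm N) \<Gamma>" "b \<in> sec (Tm N) \<Gamma>" for \<Gamma> a b
    using \<psi> that by (auto simp: bij_betw_def inj_on_def)
  \<comment> \<open>The rules for \<open>act\<close> and \<open>Typing\<close> are turned around to
    move \<open>\<phi>\<close> and \<open>\<psi>\<close> outwards, where \<open>\<phi>_eq\<close>
    can cancel \<open>\<phi>\<close>.\<close>
  note pres = DomCod[rule_format] Ident[rule_format] Comp[rule_format] Emp
    act_Ty[rule_format, symmetric] act_Tm[rule_format, symmetric] Typing[rule_format, symmetric]
    Ext[rule_format]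
  have bang: "bang N' (F \<Gamma>) = G (bang N \<Gamma>)" if "\<Gamma> \<in> Ob N.C" for \<Gamma>
    using that by (intro N'.bang_eqI) (simp_all add: pres)
  have typed: "Typing N' (F (Dom N.C \<sigma>)) (\<psi> (Dom N.C \<sigma>) a) = act (Ty N') (G \<sigma>) (\<phi> (Cod N.C \<sigma>) A) \<longleftrightarrow>
      Typing N (Dom N.C \<sigma>) a = act (Ty N) \<sigma> A"
    if "\<sigma> \<in> Arr N.C" "A \<in> sec (Ty N) (Cod N.C \<sigma>)" "a \<in> sec (Tm N) (Dom N.C \<sigma>)" for A \<sigma> a
    using that by (simp add: pres \<phi>_eq)
  have pair: "ext_pair N' (F (Cod N.C \<sigma>)) (\<phi> (Cod N.C \<sigma>) A) (G \<sigma>) (\<psi> (Dom N.C \<sigma>) a) =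
      G (ext_pair N (Cod N.C \<sigma>) A \<sigma> a)"
    if "\<sigma> \<in> Arr N.C" "A \<in> sec (Ty N) (Cod N.C \<sigma>)" "a \<in> sec (Tm N) (Dom N.C \<sigma>)"
      "Typing N (Dom N.C \<sigma>) a = act (Ty N) \<sigma> A" for A \<sigma> a
  proof -
    let ?h = "ext_pair N (Cod N.C \<sigma>) A \<sigma> a"
    note h = N.ext_pair_simps[OF that(1) refl that(2-4)]
    \<comment> \<open>The equations that characterize \<open>?h\<close>, carried over by
      \<open>G\<close> and \<open>\<psi>\<close>, show that \<open>G ?h\<close> solves the
      corresponding problem in \<open>N'\<close>.\<close>
    have 1: "Comp N'.C (Proj N' (F (Cod N.C \<sigma>)) (\<phi> (Cod N.C \<sigma>) A)) (G ?h) = G \<sigma>"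
      using that h Comp[rule_format, of ?h "Proj N (Cod N.C \<sigma>) A"]
      by (simp add: Ext)
    have 2: "act (Tm N') (G ?h) (Gen N' (F (Cod N.C \<sigma>)) (\<phi> (Cod N.C \<sigma>) A)) = \<psi> (Dom N.C \<sigma>) a"
      using that h act_Tm[rule_format, of ?h "Gen N (Cod N.C \<sigma>) A"]
      by (simp add: Ext)
    show ?thesis
      by (rule N'.ext_pair_eqI) (use that h 1 2 in \<open>simp_all add: DomCod Ext\<close>)
  qed
  have "bij_betw (transport F G \<phi> \<psi>) (nm_carrier N s) (nm_carrier N' s)" for s
  proof -
    have "inj_on (transport F G \<phi> \<psi>) (nm_carrier N s)"
      by (cases s) (auto simp: inj_on_def G_eq \<phi>_eq \<psi>_eq)
    moreover have "transport F G \<phi> \<psi> ` nm_carrier N s \<subseteq> nm_carrier N' s"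
      by (cases s) auto
    moreover have "nm_carrier N' s \<subseteq> transport F G \<phi> \<psi> ` nm_carrier N s"
    proof
      fix y assume y: "y \<in> nm_carrier N' s"
      have F_surj: "\<exists>\<Gamma> \<in> Ob N.C. \<Gamma>' = F \<Gamma>" if "\<Gamma>' \<in> Ob N'.C" for \<Gamma>'
        using F that by (auto simp: bij_betw_def)
      have "\<exists>x \<in> nm_carrier N s. y = transport F G \<phi> \<psi> x"
      proof (cases s)
        case Ctx
        with y F_surj show ?thesis by fastforce
      next
        case Sub
        with y G show ?thesis by (auto simp: bij_betw_def)
      next
        case Type
        with y obtain \<Gamma>' A' where A': "y = TypeE \<Gamma>' A'" "\<Gamma>' \<in> Ob N'.C" "A' \<in> sec (Ty N') \<Gamma>'"
          by auto
        \<comment> \<open>The tag is lifted first, because \<open>\<phi> \<Gamma>\<close> is known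
          to be onto only the sections over \<open>F \<Gamma>\<close>.\<close>
        then obtain \<Gamma> where \<Gamma>: "\<Gamma> \<in> Ob N.C" "\<Gamma>' = F \<Gamma>"
          using F_surj by blast
        then obtain A where "A \<in> sec (Ty N) \<Gamma>" "A' = \<phi> \<Gamma> A"
          using \<phi> A' by (auto simp: bij_betw_def)
        with \<Gamma> A' Type show ?thesis
          by (intro bexI[of _ "TypeE \<Gamma> A"]) auto
      next
        case Term
        with y obtain \<Gamma>' a' where a': "y = TermE \<Gamma>' a'" "\<Gamma>' \<in> Ob N'.C" "a' \<in> sec (Tm N') \<Gamma>'"
          by auto
        then obtain \<Gamma> where \<Gamma>: "\<Gamma> \<in> Ob N.C" "\<Gamma>' = F \<Gamma>"
          using F_surj by blast
        then obtain a where "a \<in> sec (Tm N) \<Gamma>" "a' = \<psi> \<Gamma> a"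
          using \<psi> a' by (auto simp: bij_betw_def)
        with \<Gamma> a' Term show ?thesis
          by (intro bexI[of _ "TermE \<Gamma> a"]) auto
      qed
      then show "y \<in> transport F G \<phi> \<psi> ` nm_carrier N s" by blast
    qed
    ultimately show ?thesis
      by (auto simp: bij_betw_def)
  qed
  moreover have "nm_oper N' f (map2 (\<lambda>_. transport F G \<phi> \<psi>) (nm_arity f) xs) =
      map_option (transport F G \<phi> \<psi>) (nm_oper N f xs)"
    if "xs \<in> listset (map (nm_carrier N) (nm_arity f))" for f xs
    using that
    by (cases f) (auto simp: in_listset_Cons_iff nm_oper_simps DomCod Ident Comp Emp act_Ty act_Tm
        Typing Ext bang typed pair)
  ultimately show ?thesis
    unfolding model_iso_def
    by (intro exI[of _ "\<lambda>_. transport F G \<phi> \<psi>"]) (simp add: model_of_def T_NM_def)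
qed

text \<open>The four component maps are \<open>h\<close> with tags stripped; each clause of
  \<open>nat_model_iso\<close> on operations is then the homomorphism condition at a suitable
  symbol.\<close>

lemma nat_model_iso_if_model_iso:
  assumes "natural_model N" "natural_model N'"
    and iso: "model_iso T_NM (model_of N) (model_of N')"
  shows "nat_model_iso N N'"
proof -
  interpret N: natural_model_structure N by unfold_locales fact
  interpret N': natural_model_structure N' by unfold_locales fact
  obtain h where h: "\<And>s. bij_betw (h s) (nm_carrier N s) (nm_carrier N' s)"
    and hom: "\<And>f xs. xs \<in> listset (map (nm_carrier N) (nm_arity f)) \<Longrightarrow>
      nm_oper N' f (map2 h (nm_arity f) xs) = map_option (h (nm_result f)) (nm_oper N f xs)"
    using iso by (auto simp: model_iso_def model_of_def T_NM_def)
  have h_in: "h s x \<in> nm_carrier N' s" if "x \<in> nm_carrier N s" for s x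
    using h that by (rule bij_betwE[rule_format])
  have h_inj: "x = y" if "h s x = h s y" "x \<in> nm_carrier N s" "y \<in> nm_carrier N s" for s x y
    using h[of s] that by (auto simp: bij_betw_def inj_on_def)
  have h_surj: "\<exists>x \<in> nm_carrier N s. h s x = y" if "y \<in> nm_carrier N' s" for s y
    using bij_betw_imp_surj_on[OF h[of s]] that by (metis imageE)
  define F where "F \<Gamma> = untag (h Ctx (CtxE \<Gamma>))" for \<Gamma>
  define G where "G \<sigma> = untag (h Sub (SubE \<sigma>))" for \<sigma>
  define \<phi> where "\<phi> \<Gamma> A = untag (h Type (TypeE \<Gamma> A))" for \<Gamma> A
  define \<psi> where "\<psi> \<Gamma> a = untag (h Term (TermE \<Gamma> a))" for \<Gamma> a
  have hF: "h Ctx (CtxE \<Gamma>) = CtxE (F \<Gamma>)" "F \<Gamma> \<in> Ob N'.C" if "\<Gamma> \<in> Ob N.C" for \<Gamma>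
    using h_in[of "CtxE \<Gamma>" Ctx] that by (auto simp: F_def)
  have hG: "h Sub (SubE \<sigma>) = SubE (G \<sigma>)" "G \<sigma> \<in> Arr N'.C" if "\<sigma> \<in> Arr N.C" for \<sigma>
    using h_in[of "SubE \<sigma>" Sub] that by (auto simp: G_def)
  \<comment> \<open>Preservation of \<open>CTXOF_TY\<close> makes \<open>h\<close> act on the tag by
    \<open>F\<close>, so its values on types over \<open>\<Gamma>\<close> stay over the single
    context \<open>F \<Gamma>\<close>.\<close>
  have h\<phi>: "h Type (TypeE \<Gamma> A) = TypeE (F \<Gamma>) (\<phi> \<Gamma> A)" "\<phi> \<Gamma> A \<in> sec (Ty N') (F \<Gamma>)"
    if "\<Gamma> \<in> Ob N.C" "A \<in> sec (Ty N) \<Gamma>" for \<Gamma> A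
    using h_in[of "TypeE \<Gamma> A" Type] hom[of "[TypeE \<Gamma> A]" CTXOF_TY] that
    by (auto simp: \<phi>_def nm_oper_simps hF)
  have h\<psi>: "h Term (TermE \<Gamma> a) = TermE (F \<Gamma>) (\<psi> \<Gamma> a)" "\<psi> \<Gamma> a \<in> sec (Tm N') (F \<Gamma>)"
    if "\<Gamma> \<in> Ob N.C" "a \<in> sec (Tm N) \<Gamma>" for \<Gamma> a
    using h_in[of "TermE \<Gamma> a" Term] hom[of "[TermE \<Gamma> a]" CTXOF_TM] that
    by (auto simp: \<psi>_def nm_oper_simps hF)
  note h_eqs = hF hG h\<phi> h\<psi>
  have F: "bij_betw F (Ob N.C) (Ob N'.C)"
  proof (rule bij_betw_imageI)
    show "inj_on F (Ob N.C)"
    proof (rule inj_onI)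
      fix x y assume "x \<in> Ob N.C" "y \<in> Ob N.C" "F x = F y"
      then show "x = y"
        using h_inj[of Ctx "CtxE x" "CtxE y"] by (simp add: hF)
    qed
  next
    show "F ` Ob N.C = Ob N'.C"
      using hF h_surj[where s = Ctx] by fastforce
  qed
  have G: "bij_betw G (Arr N.C) (Arr N'.C)"
  proof (rule bij_betw_imageI)
    show "inj_on G (Arr N.C)"
    proof (rule inj_onI)
      fix x y assume "x \<in> Arr N.C" "y \<in> Arr N.C" "G x = G y"
      then show "x = y"
        using h_inj[of Sub "SubE x" "SubE y"] by (simp add: hG)
    qed
  next
    show "G ` Arr N.C = Arr N'.C"
      using hG h_surj[where s = Sub] by fastforce
  qed
  have \<phi>: "bij_betw (\<phi> \<Gamma>) (sec (Ty N) \<Gamma>) (sec (Ty N') (F \<Gamma>))" if "\<Gamma> \<in> Ob N.C" for \<Gamma>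
  proof (rule bij_betw_imageI)
    show "inj_on (\<phi> \<Gamma>) (sec (Ty N) \<Gamma>)"
    proof (rule inj_onI)
      fix x y assume "x \<in> sec (Ty N) \<Gamma>" "y \<in> sec (Ty N) \<Gamma>" "\<phi> \<Gamma> x = \<phi> \<Gamma> y"
      then show "x = y"
        using h_inj[of Type "TypeE \<Gamma> x" "TypeE \<Gamma> y"] that by (simp add: h\<phi>)
    qed
  next
    have "\<exists>A \<in> sec (Ty N) \<Gamma>. B = \<phi> \<Gamma> A" if B: "B \<in> sec (Ty N') (F \<Gamma>)" for B
    proof -
      \<comment> \<open>The preimage comes with its own context \<open>\<Delta>\<close>; the tags
        give \<open>F \<Delta> = F \<Gamma>\<close>, and injectivity of \<open>F\<close> identifies
        the contexts.\<close>
      obtain \<Delta> A where "\<Delta> \<in> Ob N.C" "A \<in> sec (Ty N) \<Delta>" "h Type (TypeE \<Delta> A) = TypeE (F \<Gamma>) B"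
        using h_surj[of "TypeE (F \<Gamma>) B" Type] B \<open>\<Gamma> \<in> Ob N.C\<close> hF by auto
      then show ?thesis
        using F \<open>\<Gamma> \<in> Ob N.C\<close> by (auto simp: h\<phi> bij_betw_def inj_on_def)
    qed
    then show "\<phi> \<Gamma> ` sec (Ty N) \<Gamma> = sec (Ty N') (F \<Gamma>)"
      using h\<phi>(2) that by auto
  qed
  have \<psi>: "bij_betw (\<psi> \<Gamma>) (sec (Tm N) \<Gamma>) (sec (Tm N') (F \<Gamma>))" if "\<Gamma> \<in> Ob N.C" for \<Gamma>
  proof (rule bij_betw_imageI)
    show "inj_on (\<psi> \<Gamma>) (sec (Tm N) \<Gamma>)"
    proof (rule inj_onI)
      fix x y assume "x \<in> sec (Tm N) \<Gamma>" "y \<in> sec (Tm N) \<Gamma>" "\<psi> \<Gamma> x = \<psi> \<Gamma> y"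
      then show "x = y"
        using h_inj[of Term "TermE \<Gamma> x" "TermE \<Gamma> y"] that by (simp add: h\<psi>)
    qed
  next
    have "\<exists>a \<in> sec (Tm N) \<Gamma>. b = \<psi> \<Gamma> a" if b: "b \<in> sec (Tm N') (F \<Gamma>)" for b
    proof -
      obtain \<Delta> a where "\<Delta> \<in> Ob N.C" "a \<in> sec (Tm N) \<Delta>" "h Term (TermE \<Delta> a) = TermE (F \<Gamma>) b"
        using h_surj[of "TermE (F \<Gamma>) b" Term] b \<open>\<Gamma> \<in> Ob N.C\<close> hF by auto
      then show ?thesis
        using F \<open>\<Gamma> \<in> Ob N.C\<close> by (auto simp: h\<psi> bij_betw_def inj_on_def)
    qed
    then show "\<psi> \<Gamma> ` sec (Tm N) \<Gamma> = sec (Tm N') (F \<Gamma>)"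
      using h\<psi>(2) that by auto
  qed
  have DomCod: "Dom N'.C (G f) = F (Dom N.C f)" "Cod N'.C (G f) = F (Cod N.C f)"
    if "f \<in> Arr N.C" for f
    using that hom[of "[SubE f]" DOM] hom[of "[SubE f]" COD]
    by (simp_all add: nm_oper_simps h_eqs)
  have Ident: "G (Ident N.C \<Gamma>) = Ident N'.C (F \<Gamma>)" if "\<Gamma> \<in> Ob N.C" for \<Gamma>
    using that hom[of "[CtxE \<Gamma>]" ID] by (simp add: nm_oper_simps h_eqs)
  have Comp: "G (Comp N.C g f) = Comp N'.C (G g) (G f)"
    if "f \<in> Arr N.C" "g \<in> Arr N.C" "Cod N.C f = Dom N.C g" for f g
    using that hom[of "[SubE f, SubE g]" COMP] by (simp add: nm_oper_simps h_eqs DomCod)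
  have Emp: "F (Emp N) = Emp N'"
    using hom[of "[]" EMPTY] by (simp add: nm_oper_simps h_eqs)
  have act_Ty: "\<phi> (Dom N.C f) (act (Ty N) f A) = act (Ty N') (G f) (\<phi> (Cod N.C f) A)"
    if "f \<in> Arr N.C" "A \<in> sec (Ty N) (Cod N.C f)" for f A
    using that hom[of "[SubE f, TypeE (Cod N.C f) A]" SUBST_TY]
    by (simp add: nm_oper_simps h_eqs DomCod)
  have act_Tm: "\<psi> (Dom N.C f) (act (Tm N) f a) = act (Tm N') (G f) (\<psi> (Cod N.C f) a)"
    if "f \<in> Arr N.C" "a \<in> sec (Tm N) (Cod N.C f)" for f a
    using that hom[of "[SubE f, TermE (Cod N.C f) a]" SUBST_TM]
    by (simp add: nm_oper_simps h_eqs DomCod)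
  have Typing: "\<phi> \<Gamma> (Typing N \<Gamma> a) = Typing N' (F \<Gamma>) (\<psi> \<Gamma> a)"
    if "\<Gamma> \<in> Ob N.C" "a \<in> sec (Tm N) \<Gamma>" for \<Gamma> a
    using that hom[of "[TermE \<Gamma> a]" TYPEOF] by (simp add: nm_oper_simps h_eqs)
  have Ext: "F (Ext N \<Gamma> A) = Ext N' (F \<Gamma>) (\<phi> \<Gamma> A)" "G (Proj N \<Gamma> A) = Proj N' (F \<Gamma>) (\<phi> \<Gamma> A)"
    "\<psi> (Ext N \<Gamma> A) (Gen N \<Gamma> A) = Gen N' (F \<Gamma>) (\<phi> \<Gamma> A)"
    if "\<Gamma> \<in> Ob N.C" "A \<in> sec (Ty N) \<Gamma>" for \<Gamma> A
    using that hom[of "[TypeE \<Gamma> A]" CEXT] hom[of "[TypeE \<Gamma> A]" PROJ] hom[of "[TypeE \<Gamma> A]" VAR]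
    by (simp_all add: nm_oper_simps h_eqs)
  show ?thesis
    unfolding nat_model_iso_def Let_def
    by (intro exI[of _ F] exI[of _ G] exI[of _ \<phi>] exI[of _ \<psi>])
      (simp add: F G \<phi> \<psi> DomCod Ident Comp Emp act_Ty act_Tm Typing Ext)
qed

section \<open>Assembling the equivalence\<close>

lemma nat_model_iso_iff_model_iso:
  assumes "natural_model N" "natural_model N'"
  shows "nat_model_iso N N' \<longleftrightarrow> model_iso T_NM (model_of N) (model_of N')"
  using assms model_iso_if_nat_model_iso nat_model_iso_if_model_iso by blast

lemma eat_model_model_of:
  assumes "natural_model N"
  shows "eat_model T_NM (model_of N) \<and> satisfies (model_of N) esub_empty"
proof -
  interpret natural_model_structure N by unfold_locales fact
  show ?thesis
    using model_of_T_NM model_of_esub_empty by blast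
qed

lemma natural_model_nat_model_of_iff:
  assumes "eat_model T_NM M"
  shows "natural_model (nat_model_of M) \<longleftrightarrow> satisfies M esub_empty"
  using assms by (intro nm_theory_model.natural_model_nat_model_of_iff) unfold_locales

text \<open>As \<open>model_of\<close> reflects isomorphism, it suffices to compare the models built
  from the two sides; this is the other round trip at \<open>model_of N\<close>.\<close>

lemma nat_model_iso_nat_model_of_model_of:
  assumes N: "natural_model N"
  shows "nat_model_iso (nat_model_of (model_of N)) N"
proof -
  note M = eat_model_model_of[OF N]
  from M have "natural_model (nat_model_of (model_of N))"
    by (simp add: natural_model_nat_model_of_iff)
  then show ?thesis
    using M N by (simp add: nat_model_iso_iff_model_iso model_iso_model_of_nat_model_of)
qed

lemma model_iso_iff_nat_model_iso:
  assumes M: "eat_model T_NM M" "satisfies M esub_empty"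
    and M': "eat_model T_NM M'" "satisfies M' esub_empty"
  shows "model_iso T_NM M M' \<longleftrightarrow> nat_model_iso (nat_model_of M) (nat_model_of M')"
proof -
  have nat: "natural_model (nat_model_of M)" "natural_model (nat_model_of M')"
    using M M' by (simp_all add: natural_model_nat_model_of_iff)
  let ?K = "model_of (nat_model_of M)" and ?K' = "model_of (nat_model_of M')"
  have iso: "model_iso T_NM ?K M" "model_iso T_NM ?K' M'"
    using M M' by (simp_all add: model_iso_model_of_nat_model_of)
  \<comment> \<open>Inverting requires the source to be a model; for \<open>?K\<close> and
    \<open>?K'\<close> this is \<open>eat_model_model_of\<close>.\<close>
  have iso_inv: "model_iso T_NM M ?K" "model_iso T_NM M' ?K'"
    using iso nat eat_model_model_of model_iso_sym by blast+
  have "model_iso T_NM M M' \<longleftrightarrow> model_iso T_NM ?K ?K'"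
  proof
    assume "model_iso T_NM M M'"
    with iso(1) have "model_iso T_NM ?K M'" by (rule model_iso_trans)
    then show "model_iso T_NM ?K ?K'" using iso_inv(2) by (rule model_iso_trans)
  next
    assume "model_iso T_NM ?K ?K'"
    with iso_inv(1) have "model_iso T_NM M ?K'" by (rule model_iso_trans)
    then show "model_iso T_NM M M'" using iso(2) by (rule model_iso_trans)
  qed
  then show ?thesis
    using nat by (simp add: nat_model_iso_iff_model_iso)
qed

theorem theorem2p2p2:
  shows "ess_alg_theory T_NM \<and>
    (\<forall>M :: (nm_sort, nm_symbol, 'u) interp. eat_model T_NM M \<longrightarrow>
       (natural_model (nat_model_of M) \<longleftrightarrow> satisfies M esub_empty)) \<and>
    (\<forall>N :: 'u nat_model. natural_model N \<longrightarrow>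
       eat_model T_NM (model_of N) \<and> satisfies (model_of N) esub_empty) \<and>
    (\<forall>M :: (nm_sort, nm_symbol, 'u) interp. eat_model T_NM M \<and> satisfies M esub_empty \<longrightarrow>
       model_iso T_NM (model_of (nat_model_of M)) M) \<and>
    (\<forall>N :: 'u nat_model. natural_model N \<longrightarrow> nat_model_iso (nat_model_of (model_of N)) N) \<and>
    (\<forall>(M :: (nm_sort, nm_symbol, 'u) interp) (M' :: (nm_sort, nm_symbol, 'v) interp).
       eat_model T_NM M \<and> satisfies M esub_empty \<and>
       eat_model T_NM M' \<and> satisfies M' esub_empty \<longrightarrow>
       (model_iso T_NM M M' \<longleftrightarrow> nat_model_iso (nat_model_of M) (nat_model_of M'))) \<and>
    (\<forall>(N :: 'u nat_model) (N' :: 'v nat_model). natural_model N \<and> natural_model N' \<longrightarrow>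
       (nat_model_iso N N' \<longleftrightarrow> model_iso T_NM (model_of N) (model_of N')))"
  using ess_alg_theory_T_NM natural_model_nat_model_of_iff eat_model_model_of
    model_iso_model_of_nat_model_of nat_model_iso_nat_model_of_model_of
    model_iso_iff_nat_model_iso nat_model_iso_iff_model_iso
  by (intro conjI allI impI) blast+

end
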